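(* Let $D\ge 2$, let $\Lambda\in\mathbb R$, let $\sigma$ be a compact $D$-dimensional spatial slice in a solution $(M,g,\Phi)$ of general relativity with cosmological constant $\Lambda$ conformally coupled to a scalar field, let $(q_{ab},P^{ab},\Phi,\pi_\Phi)$ be the induced canonical data on $\sigma$ with $a(\Phi)\neq0$ everywhere, and let $\delta\in\mathbb R$. Suppose that the gauge condition $\mathcal D_\delta=\mathcal D-\sqrt q\,\delta=0$ holds on $\sigma$, and that the energy-momentum tensor $T_{\mu\nu}$ of the scalar field satisfies the weak energy condition. Put $$\mathcal P=\frac{\kappa^2}{2q\,a(\Phi)^2}P^{ab}_{\mathrm{tf}}P^{\mathrm{tf}}_{ab}+\frac12R^{(D)}+\delta^2\frac{\kappa^2(D+1)}{2(\Delta^g)^2D(D-1)^2}-\frac{D+1}{D-1}\Lambda .$$ Then $$\mathcal P\ \ge\ \delta^2\frac{\kappa^2}{(\Delta^g)^2D(D-1)^2}-\frac{2}{D-1}\Lambda$$ on $\sigma$. Consequently, if $$\delta^2>\frac{2(\Delta^g)^2D(D-1)}{\kappa^2}\Lambda$$ (which is always satisfied when $\Lambda<0$), then the equation $[D_aD^a-\mathcal P(x)]N(x)=0$ on $\sigma$ (with $N|_{\partial\sigma}=0$ if $\partial\sigma\ne\emptyset$) has $N=0$ as its unique solution, so that $\mathcal D_\delta$ is locally a good gauge fixing condition for the Hamiltonian constraint.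
   Context: The theory has action on the $(D+1)$-dimensional globally hyperbolic spacetime $M$ (signature mostly plus) $$S=\frac1\kappa\int_M d^{D+1}X\sqrt{|g|}\,R^{(D+1)}a(\Phi)+\frac1{2\lambda}\int_M d^{D+1}X\sqrt{|g|}\,g^{\mu\nu}(\nabla_\mu\Phi)(\nabla_\nu\Phi)-\frac2\kappa\int_M d^{D+1}X\sqrt{|g|}\,\Lambda,$$ $$a(\Phi)=1-\alpha\Phi^2,\qquad \alpha=-\frac{\kappa(D-1)}{8\lambda D},$$ with nonzero coupling constants $\kappa>0$ and $\lambda$ (in the paper's conventions $\kappa/\lambda<0$). The fixed nonzero number $\Delta^g$ is the conformal weight of the metric, and $\Delta^\Phi=\frac{1-D}{4}\Delta^g$ is that of $\Phi$. The metric field equation is written $G_{\mu\nu}+\Lambda g_{\mu\nu}=8\pi T_{\mu\nu}$, where $T_{\mu\nu}$ is the energy-momentum tensor of $\Phi$. On the slice: $q_{ab}$ is the induced Riemannian metric, $q$ its determinant, $D_a$ its Levi-Civita derivative, $R^{(D)}$ its scalar curvature, $n^\mu$ the future pointing unit normal, $K_{ab}$ the extrinsic curvature and $K=q^{ab}K_{ab}$. The canonical momenta are $$\pi_\Phi=-\frac1\lambda\sqrt q\,(\mathcal L_n\Phi)+\frac{4\alpha}{\kappa}\sqrt q\,\Phi K,\qquad P^{ab}=\frac1\kappa a(\Phi)\sqrt q\,(K^{ab}-q^{ab}K)+\frac{2\alpha}{\kappa}\sqrt q\,q^{ab}\Phi(\mathcal L_n\Phi).$$ Write $P=q_{ab}P^{ab}$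 and $P^{ab}_{\mathrm{tf}}=P^{ab}-\frac1Dq^{ab}P$. The generator of local conformal transformations is $\mathcal D=\Delta^gP+\Delta^\Phi\pi_\Phi\Phi$; one has $\mathcal D=-\frac{(D-1)\Delta^g}{\kappa}\sqrt q\,K$, so $\mathcal D_\delta=0$ says that $\sigma$ has constant mean curvature. Let $\mathcal H[N]$ be the Hamiltonian constraint of the theory (including the cosmological term $\frac2\kappa\sqrt q\,\Lambda$), smeared with the lapse $N$, and let $\mathcal D_\delta[\rho]=\int_\sigma d^Dx\,\rho\,\mathcal D_\delta$. On the surface where the constraints hold, $\{\kappa\mathcal H[N],\mathcal D_\delta[\rho]\}=\int_\sigma d^Dx\,(D-1)\sqrt q\,\Delta^g\rho\,[D_aD^a-\mathcal P]N$. "Locally a good gauge fixing" means that this (formally self-adjoint) operator acting on $N$ has trivial kernel. Functions $N$ are smooth real functions on $\sigma$. The weak energy condition is $T_{\mu\nu}\zeta^\mu\zeta^\nu\ge0$ for all future timelike vectors $\zeta$. *)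

theory Defs
  imports "HOL-Analysis.Analysis"
begin

section \<open>Smooth functions and partial derivatives on coordinate space\<close>

text \<open>Derivatives are taken within a set \<open>S\<close>, so that functions on a half-space have one-sided
  derivatives at the bounding hyperplane; \<open>S = UNIV\<close> gives the ordinary derivative.\<close>

definition partial :: "(real^'n) set \<Rightarrow> 'n::finite \<Rightarrow> (real^'n \<Rightarrow> real) \<Rightarrow> real^'n \<Rightarrow> real" where
  "partial S i f x = frechet_derivative f (at x within S) (axis i 1)"

primrec Ck_on :: "nat \<Rightarrow> (real^'n::finite) set \<Rightarrow> (real^'n \<Rightarrow> real) \<Rightarrow> bool" where
  "Ck_on 0 S f \<longleftrightarrow> continuous_on S f"
| "Ck_on (Suc k) S f \<longleftrightarrow>
     (\<forall>x\<in>S. f differentiable (at x)) \<and> (\<forall>i. Ck_on k S (partial UNIV i f))"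

text \<open>Only used for open \<open>S\<close>.\<close>

definition smooth_on :: "(real^'n::finite) set \<Rightarrow> (real^'n \<Rightarrow> real) \<Rightarrow> bool" where
  "smooth_on S f \<longleftrightarrow> (\<forall>k. Ck_on k S f)"


section \<open>Smooth manifolds\<close>

text \<open>A chart is a pair of its domain and its coordinate map; the values of the map outside the
  domain are irrelevant. The manifold is the whole type \<open>'m\<close>.\<close>

type_synonym ('m, 'n) chart = "'m set \<times> ('m \<Rightarrow> real^'n)"

definition codom :: "('m, 'n::finite) chart \<Rightarrow> (real^'n) set" where
  "codom c = snd c ` fst c"

definition param :: "('m, 'n::finite) chart \<Rightarrow> real^'n \<Rightarrow> 'm" where
  "param c = inv_into (fst c) (snd c)"

definition is_chart :: "('m::topological_space, 'n::finite) chart \<Rightarrow> bool" where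
  "is_chart c \<longleftrightarrow> open (fst c) \<and> open (codom c) \<and>
     homeomorphism (fst c) (codom c) (snd c) (param c)"

definition transition :: "('m, 'n::finite) chart \<Rightarrow> ('m, 'n) chart \<Rightarrow> real^'n \<Rightarrow> real^'n" where
  "transition c c' = snd c' \<circ> param c"

definition compatible :: "('m, 'n::finite) chart \<Rightarrow> ('m, 'n) chart \<Rightarrow> bool" where
  "compatible c c' \<longleftrightarrow>
     (\<forall>i. smooth_on (snd c ` (fst c \<inter> fst c')) (\<lambda>x. transition c c' x $ i)) \<and>
     (\<forall>i. smooth_on (snd c' ` (fst c \<inter> fst c')) (\<lambda>x. transition c' c x $ i))"

definition maximal_atlas :: "('m::topological_space, 'n::finite) chart set \<Rightarrow> bool" where
  "maximal_atlas A \<longleftrightarrow>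
     (\<forall>c\<in>A. is_chart c) \<and> (\<Union>c\<in>A. fst c) = UNIV \<and>
     (\<forall>c\<in>A. \<forall>c'\<in>A. compatible c c') \<and>
     (\<forall>c. is_chart c \<and> (\<forall>c'\<in>A. compatible c c') \<longrightarrow> c \<in> A)"

definition smooth_fun_on :: "('m::topological_space, 'n::finite) chart set \<Rightarrow> 'm set \<Rightarrow> ('m \<Rightarrow> real) \<Rightarrow> bool" where
  "smooth_fun_on A W f \<longleftrightarrow> (\<forall>c\<in>A. smooth_on (snd c ` (fst c \<inter> W)) (f \<circ> param c))"


section \<open>Levi-Civita calculus of a metric given by its components\<close>

definition christoffel :: "(real^'n \<Rightarrow> real^'n^'n) \<Rightarrow> real^'n \<Rightarrow> 'n::finite \<Rightarrow> 'n \<Rightarrow> 'n \<Rightarrow> real" where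
  "christoffel h x k i j = (1/2) * (\<Sum>l\<in>UNIV. matrix_inv (h x) $ k $ l *
     (partial UNIV i (\<lambda>y. h y $ j $ l) x + partial UNIV j (\<lambda>y. h y $ i $ l) x
      - partial UNIV l (\<lambda>y. h y $ i $ j) x))"

text \<open>\<open>riemann h x k l i j\<close> is $R^k{}_{lij}$, with $R^k{}_{lij} V^l = [\nabla_i, \nabla_j] V^k$.\<close>

definition riemann :: "(real^'n \<Rightarrow> real^'n^'n) \<Rightarrow> real^'n \<Rightarrow> 'n::finite \<Rightarrow> 'n \<Rightarrow> 'n \<Rightarrow> 'n \<Rightarrow> real" where
  "riemann h x k l i j =
     partial UNIV i (\<lambda>y. christoffel h y k j l) x - partial UNIV j (\<lambda>y. christoffel h y k i l) x
     + (\<Sum>m\<in>UNIV. christoffel h x k i m * christoffel h x m j l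
                  - christoffel h x k j m * christoffel h x m i l)"

definition ricci :: "(real^'n \<Rightarrow> real^'n^'n) \<Rightarrow> real^'n \<Rightarrow> real^'n::finite^'n" where
  "ricci h x = (\<chi> l j. \<Sum>k\<in>UNIV. riemann h x k l k j)"

definition scalar_curv :: "(real^'n \<Rightarrow> real^'n^'n) \<Rightarrow> real^'n::finite \<Rightarrow> real" where
  "scalar_curv h x = (\<Sum>i\<in>UNIV. \<Sum>j\<in>UNIV. matrix_inv (h x) $ i $ j * ricci h x $ i $ j)"

definition einstein :: "(real^'n \<Rightarrow> real^'n^'n) \<Rightarrow> real^'n \<Rightarrow> real^'n::finite^'n" where
  "einstein h x = (\<chi> i j. ricci h x $ i $ j - (1/2) * scalar_curv h x * h x $ i $ j)"

definition cov_hessian ::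
  "(real^'n \<Rightarrow> real^'n^'n) \<Rightarrow> (real^'n) set \<Rightarrow> (real^'n \<Rightarrow> real) \<Rightarrow> real^'n \<Rightarrow> real^'n::finite^'n" where
  "cov_hessian h S f x = (\<chi> i j. partial S i (partial S j f) x
      - (\<Sum>k\<in>UNIV. christoffel h x k i j * partial S k f x))"

definition laplacian ::
  "(real^'n \<Rightarrow> real^'n^'n) \<Rightarrow> (real^'n) set \<Rightarrow> (real^'n \<Rightarrow> real) \<Rightarrow> real^'n::finite \<Rightarrow> real" where
  "laplacian h S f x =
     (\<Sum>i\<in>UNIV. \<Sum>j\<in>UNIV. matrix_inv (h x) $ i $ j * cov_hessian h S f x $ i $ j)"

definition bil :: "real^'n^'n \<Rightarrow> real^'n \<Rightarrow> real^'n::finite \<Rightarrow> real" where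
  "bil G v w = v \<bullet> (G *v w)"


section \<open>Spacetimes\<close>

text \<open>For a \<open>D\<close>-element index type \<open>'d\<close>, spacetime coordinates are indexed by \<open>'d option\<close>, which
  has \<open>D + 1\<close> elements. Tensor fields are families of components, one for each chart, related by
  the tensor transformation law. \<open>orient\<close> is a timelike vector field fixing the time orientation,
  \<open>phi\<close> is the scalar field.\<close>

record ('m, 'd) spacetime =
  atlas :: "('m, 'd::finite option) chart set"
  gmet :: "('m, 'd option) chart \<Rightarrow> real^('d option) \<Rightarrow> real^('d option)^('d option)"
  orient :: "('m, 'd option) chart \<Rightarrow> real^('d option) \<Rightarrow> real^('d option)"
  phi :: "'m \<Rightarrow> real"

definition minkowski :: "real^('d::finite option)^('d option)" where
  "minkowski = (\<chi> i j. if i \<noteq> j then 0 else if i = None then - 1 else 1)"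

definition lorentzian :: "real^('d::finite option)^('d option) \<Rightarrow> bool" where
  "lorentzian G \<longleftrightarrow> transpose G = G \<and> 
     (\<exists>E :: real^('d option)^('d option). invertible E \<and> transpose E ** G ** E = minkowski)"

definition lorentzian_metric :: "('m::topological_space, 'd::finite) spacetime \<Rightarrow> bool" where
  "lorentzian_metric M \<longleftrightarrow>
     (\<forall>c\<in>atlas M. (\<forall>x\<in>codom c. lorentzian (gmet M c x)) \<and>
        (\<forall>i j. smooth_on (codom c) (\<lambda>x. gmet M c x $ i $ j))) \<and>
     (\<forall>c\<in>atlas M. \<forall>c'\<in>atlas M. \<forall>p\<in>fst c \<inter> fst c'.
        (let J = jacobian (transition c c') (at (snd c p))
         in gmet M c (snd c p) = transpose J ** gmet M c' (snd c' p) ** J))"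

definition time_orientation :: "('m::topological_space, 'd::finite) spacetime \<Rightarrow> bool" where
  "time_orientation M \<longleftrightarrow>
     (\<forall>c\<in>atlas M. continuous_on (codom c) (orient M c) \<and>
        (\<forall>x\<in>codom c. bil (gmet M c x) (orient M c x) (orient M c x) < 0)) \<and>
     (\<forall>c\<in>atlas M. \<forall>c'\<in>atlas M. \<forall>p\<in>fst c \<inter> fst c'.
        orient M c' (snd c' p) = jacobian (transition c c') (at (snd c p)) *v orient M c (snd c p))"

definition future_causal ::
  "('m, 'd::finite) spacetime \<Rightarrow> ('m, 'd option) chart \<Rightarrow> real^('d option) \<Rightarrow> real^('d option) \<Rightarrow> bool" where
  "future_causal M c x v \<longleftrightarrow>
     v \<noteq> 0 \<and> bil (gmet M c x) v v \<le> 0 \<and> bil (gmet M c x) (orient M c x) v < 0"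

definition future_timelike ::
  "('m, 'd::finite) spacetime \<Rightarrow> ('m, 'd option) chart \<Rightarrow> real^('d option) \<Rightarrow> real^('d option) \<Rightarrow> bool" where
  "future_timelike M c x v \<longleftrightarrow>
     bil (gmet M c x) v v < 0 \<and> bil (gmet M c x) (orient M c x) v < 0"

definition causal_curve ::
  "('m::topological_space, 'd::finite) spacetime \<Rightarrow> (real \<Rightarrow> 'm) \<Rightarrow> bool" where
  "causal_curve M \<gamma> \<longleftrightarrow> continuous_on {0..1} \<gamma> \<and>
     (\<forall>c\<in>atlas M. let I = {t\<in>{0..1}. \<gamma> t \<in> fst c} in
        \<exists>v. continuous_on I v \<and>
          (\<forall>t\<in>I. ((snd c \<circ> \<gamma>) has_vector_derivative v t) (at t within {0..1}) \<and>
                 future_causal M c (snd c (\<gamma> t)) (v t)))"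

text \<open>The transitive closure of \<open>causal_step\<close> is causal precedence along piecewise
  continuously differentiable curves.\<close>

definition causal_step :: "('m::topological_space, 'd::finite) spacetime \<Rightarrow> 'm \<Rightarrow> 'm \<Rightarrow> bool" where
  "causal_step M p r \<longleftrightarrow> (\<exists>\<gamma>. causal_curve M \<gamma> \<and> \<gamma> 0 = p \<and> \<gamma> 1 = r)"

definition globally_hyperbolic :: "('m::topological_space, 'd::finite) spacetime \<Rightarrow> bool" where
  "globally_hyperbolic M \<longleftrightarrow>
     (\<forall>p. \<not> (causal_step M)\<^sup>+\<^sup>+ p p) \<and>
     (\<forall>p s. compact {r. (causal_step M)\<^sup>*\<^sup>* p r \<and> (causal_step M)\<^sup>*\<^sup>* r s})"

definition spacetime_with_scalar :: "('m::topological_space, 'd::finite) spacetime \<Rightarrow> bool" where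
  "spacetime_with_scalar M \<longleftrightarrow> maximal_atlas (atlas M) \<and> lorentzian_metric M \<and>
     time_orientation M \<and> globally_hyperbolic M \<and> smooth_fun_on (atlas M) UNIV (phi M)"


section \<open>The conformally coupled scalar field\<close>

text \<open>\<open>lam\<close> is the coupling constant $\lambda$ of the action
  $$S = \frac1\kappa\int\sqrt{|g|}\,R\,a(\Phi)
    + \frac1{2\lambda}\int\sqrt{|g|}\,(\partial\Phi)^2 - \frac2\kappa\int\sqrt{|g|}\,\Lambda .$$\<close>

definition alpha :: "'d itself \<Rightarrow> real \<Rightarrow> real \<Rightarrow> real" where
  "alpha (_ :: 'd itself) \<kappa> lam = - (\<kappa> * (real CARD('d) - 1) / (8 * lam * real CARD('d)))"

definition a_of :: "'d itself \<Rightarrow> real \<Rightarrow> real \<Rightarrow> real \<Rightarrow> real" where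
  "a_of (_ :: 'd itself) \<kappa> lam \<phi> = 1 - alpha TYPE('d) \<kappa> lam * \<phi>\<^sup>2"

text \<open>Varying the action with respect to $g^{\mu\nu}$ gives
  $$a\,G_{\mu\nu} + g_{\mu\nu}\Box a - \nabla_\mu\nabla_\nu a
    + \frac{\kappa}{2\lambda}\Bigl(\partial_\mu\Phi\,\partial_\nu\Phi
    - \frac12 g_{\mu\nu}(\partial\Phi)^2\Bigr) + \Lambda g_{\mu\nu} = 0$$
  with $a = 1 - \alpha\Phi^2$. Collecting all terms that contain $\Phi$ on the right-hand side gives
  $G_{\mu\nu} + \Lambda g_{\mu\nu} = 8\pi T_{\mu\nu}$ with the following tensor.\<close>

definition energy_momentum ::
  "real \<Rightarrow> real \<Rightarrow> ('m, 'd::finite) spacetime \<Rightarrow> ('m, 'd option) chart \<Rightarrow> real^('d option)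
     \<Rightarrow> real^('d option)^('d option)" where
  "energy_momentum \<kappa> lam M c x =
    (let g = gmet M c; G = g x; \<phi> = phi M \<circ> param c; \<phi>sq = (\<lambda>y. (\<phi> y)\<^sup>2);
         d\<phi> = (\<lambda>i. partial UNIV i \<phi> x);
         kin = (\<Sum>i\<in>UNIV. \<Sum>j\<in>UNIV. matrix_inv G $ i $ j * d\<phi> i * d\<phi> j)
     in (\<chi> i j. (1 / (8 * pi)) *
          (- (\<kappa> / (2 * lam)) * (d\<phi> i * d\<phi> j - (1/2) * G $ i $ j * kin)
           + alpha TYPE('d) \<kappa> lam *
               (einstein g x $ i $ j * \<phi>sq x + G $ i $ j * laplacian g UNIV \<phi>sq x
                - cov_hessian g UNIV \<phi>sq x $ i $ j))))"

text \<open>The second equation is the Euler-Lagrange equation of $\Phi$,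
  $\frac1\kappa R\,a'(\Phi) - \frac1\lambda\Box\Phi = 0$.\<close>

definition field_equations ::
  "real \<Rightarrow> real \<Rightarrow> real \<Rightarrow> ('m, 'd::finite) spacetime \<Rightarrow> bool" where
  "field_equations \<kappa> lam \<Lambda> M \<longleftrightarrow>
     (\<forall>c\<in>atlas M. \<forall>x\<in>codom c.
        einstein (gmet M c) x + \<Lambda> *\<^sub>R gmet M c x = (8 * pi) *\<^sub>R energy_momentum \<kappa> lam M c x \<and>
        (1 / \<kappa>) * scalar_curv (gmet M c) x * deriv (a_of TYPE('d) \<kappa> lam) (phi M (param c x))
          - (1 / lam) * laplacian (gmet M c) UNIV (phi M \<circ> param c) x = 0)"

definition weak_energy_condition ::
  "real \<Rightarrow> real \<Rightarrow> ('m, 'd::finite) spacetime \<Rightarrow> bool" where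
  "weak_energy_condition \<kappa> lam M \<longleftrightarrow>
     (\<forall>c\<in>atlas M. \<forall>x\<in>codom c. \<forall>\<zeta>. future_timelike M c x \<zeta> \<longrightarrow>
        bil (energy_momentum \<kappa> lam M c x) \<zeta> \<zeta> \<ge> 0)"


section \<open>Spatial slices\<close>

definition emb :: "real^'d::finite \<Rightarrow> real^('d option)" where
  "emb y = (\<chi> i. case i of None \<Rightarrow> 0 | Some a \<Rightarrow> y $ a)"

definition spat :: "('m, 'd::finite option) chart \<Rightarrow> 'm \<Rightarrow> real^'d" where
  "spat c p = (\<chi> a. snd c p $ Some a)"

definition interior_slice_chart ::
  "('m, 'd::finite) spacetime \<Rightarrow> 'm set \<Rightarrow> ('m, 'd option) chart \<Rightarrow> bool" where
  "interior_slice_chart M \<sigma> c \<longleftrightarrow> c \<in> atlas M \<and> \<sigma> \<inter> fst c = {p \<in> fst c. snd c p $ None = 0}"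

definition boundary_slice_chart ::
  "('m, 'd::finite) spacetime \<Rightarrow> 'm set \<Rightarrow> 'd \<Rightarrow> ('m, 'd option) chart \<Rightarrow> bool" where
  "boundary_slice_chart M \<sigma> b c \<longleftrightarrow> c \<in> atlas M \<and>
     \<sigma> \<inter> fst c = {p \<in> fst c. snd c p $ None = 0 \<and> snd c p $ Some b \<ge> 0}"

definition slice_charts_at ::
  "('m, 'd::finite) spacetime \<Rightarrow> 'm set \<Rightarrow> 'm \<Rightarrow> ('m, 'd option) chart set" where
  "slice_charts_at M \<sigma> p =
     {c. p \<in> fst c \<and> (interior_slice_chart M \<sigma> c \<or> (\<exists>b. boundary_slice_chart M \<sigma> b c))}"

definition slice_boundary :: "('m, 'd::finite) spacetime \<Rightarrow> 'm set \<Rightarrow> 'm set" where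
  "slice_boundary M \<sigma> =
     {p\<in>\<sigma>. \<exists>b c. boundary_slice_chart M \<sigma> b c \<and> p \<in> fst c \<and> snd c p $ Some b = 0}"

text \<open>Induced metric in the slice coordinates \<open>y\<close>. It is defined on the whole hypersurface
  \<open>x $ None = 0\<close> of the chart, hence on a neighbourhood of every point of \<open>\<sigma>\<close>, including the
  boundary points, so that its derivatives are two-sided.\<close>

definition qmet :: "('m, 'd::finite) spacetime \<Rightarrow> ('m, 'd option) chart \<Rightarrow> real^'d \<Rightarrow> real^'d^'d" where
  "qmet M c y = (\<chi> a b. gmet M c (emb y) $ Some a $ Some b)"

definition compact_spatial_slice ::
  "('m::topological_space, 'd::finite) spacetime \<Rightarrow> 'm set \<Rightarrow> bool" where
  "compact_spatial_slice M \<sigma> \<longleftrightarrow> compact \<sigma> \<and>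
     (\<forall>p\<in>\<sigma>. slice_charts_at M \<sigma> p \<noteq> {} \<and>
        (\<forall>c\<in>slice_charts_at M \<sigma> p. \<forall>v. v \<noteq> 0 \<longrightarrow> bil (qmet M c (spat c p)) v v > 0))"

text \<open>Future pointing unit normal $n^\mu$.\<close>

definition unit_normal ::
  "('m, 'd::finite) spacetime \<Rightarrow> ('m, 'd option) chart \<Rightarrow> real^'d \<Rightarrow> real^('d option)" where
  "unit_normal M c y = (let G = gmet M c (emb y) in
     THE n. bil G n n = - 1 \<and> (\<forall>a. bil G n (axis (Some a) 1) = 0) \<and>
            bil G (orient M c (emb y)) n < 0)"

text \<open>The sign convention is $K_{ab} = \frac12(\mathcal L_n q)_{ab} = \nabla_a n_b$. As $n_b = 0$
  along the slice in adapted coordinates, $\nabla_a n_b = - n_\mu \Gamma^\mu{}_{ab}$.\<close>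

definition Kext :: "('m, 'd::finite) spacetime \<Rightarrow> ('m, 'd option) chart \<Rightarrow> real^'d \<Rightarrow> real^'d^'d" where
  "Kext M c y = (\<chi> a b. - (\<Sum>\<mu>\<in>UNIV. (gmet M c (emb y) *v unit_normal M c y) $ \<mu> *
       christoffel (gmet M c) (emb y) \<mu> (Some a) (Some b)))"

definition Kup :: "('m, 'd::finite) spacetime \<Rightarrow> ('m, 'd option) chart \<Rightarrow> real^'d \<Rightarrow> real^'d^'d" where
  "Kup M c y = (let qi = matrix_inv (qmet M c y) in
     (\<chi> a b. \<Sum>d\<in>UNIV. \<Sum>e\<in>UNIV. qi $ a $ d * qi $ b $ e * Kext M c y $ d $ e))"

definition Ktr :: "('m, 'd::finite) spacetime \<Rightarrow> ('m, 'd option) chart \<Rightarrow> real^'d \<Rightarrow> real" where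
  "Ktr M c y = (\<Sum>a\<in>UNIV. \<Sum>b\<in>UNIV. matrix_inv (qmet M c y) $ a $ b * Kext M c y $ a $ b)"

definition sqrt_q :: "('m, 'd::finite) spacetime \<Rightarrow> ('m, 'd option) chart \<Rightarrow> real^'d \<Rightarrow> real" where
  "sqrt_q M c y = sqrt (det (qmet M c y))"

definition phi_slice :: "('m, 'd::finite) spacetime \<Rightarrow> ('m, 'd option) chart \<Rightarrow> real^'d \<Rightarrow> real" where
  "phi_slice M c y = phi M (param c (emb y))"

definition Ln_phi :: "('m, 'd::finite) spacetime \<Rightarrow> ('m, 'd option) chart \<Rightarrow> real^'d \<Rightarrow> real" where
  "Ln_phi M c y =
     (\<Sum>\<mu>\<in>UNIV. unit_normal M c y $ \<mu> * partial UNIV \<mu> (phi M \<circ> param c) (emb y))"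


section \<open>Canonical data, the conformal generator and the gauge condition\<close>

definition pi_phi ::
  "real \<Rightarrow> real \<Rightarrow> ('m, 'd::finite) spacetime \<Rightarrow> ('m, 'd option) chart \<Rightarrow> real^'d \<Rightarrow> real" where
  "pi_phi \<kappa> lam M c y = - (1 / lam) * sqrt_q M c y * Ln_phi M c y
     + (4 * alpha TYPE('d) \<kappa> lam / \<kappa>) * sqrt_q M c y * phi_slice M c y * Ktr M c y"

definition Pup ::
  "real \<Rightarrow> real \<Rightarrow> ('m, 'd::finite) spacetime \<Rightarrow> ('m, 'd option) chart \<Rightarrow> real^'d \<Rightarrow> real^'d^'d" where
  "Pup \<kappa> lam M c y = (let qi = matrix_inv (qmet M c y) in
     (\<chi> a b. (1 / \<kappa>) * a_of TYPE('d) \<kappa> lam (phi_slice M c y) * sqrt_q M c y *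
               (Kup M c y $ a $ b - qi $ a $ b * Ktr M c y)
             + (2 * alpha TYPE('d) \<kappa> lam / \<kappa>) * sqrt_q M c y * qi $ a $ b *
               phi_slice M c y * Ln_phi M c y))"

definition Ptr ::
  "real \<Rightarrow> real \<Rightarrow> ('m, 'd::finite) spacetime \<Rightarrow> ('m, 'd option) chart \<Rightarrow> real^'d \<Rightarrow> real" where
  "Ptr \<kappa> lam M c y = (\<Sum>a\<in>UNIV. \<Sum>b\<in>UNIV. qmet M c y $ a $ b * Pup \<kappa> lam M c y $ a $ b)"

definition Ptf ::
  "real \<Rightarrow> real \<Rightarrow> ('m, 'd::finite) spacetime \<Rightarrow> ('m, 'd option) chart \<Rightarrow> real^'d \<Rightarrow> real^'d^'d" where
  "Ptf \<kappa> lam M c y = (\<chi> a b. Pup \<kappa> lam M c y $ a $ b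
     - (1 / real CARD('d)) * matrix_inv (qmet M c y) $ a $ b * Ptr \<kappa> lam M c y)"

definition Ptf_sq ::
  "real \<Rightarrow> real \<Rightarrow> ('m, 'd::finite) spacetime \<Rightarrow> ('m, 'd option) chart \<Rightarrow> real^'d \<Rightarrow> real" where
  "Ptf_sq \<kappa> lam M c y = (let q = qmet M c y; P = Ptf \<kappa> lam M c y in
     \<Sum>a\<in>UNIV. \<Sum>b\<in>UNIV. \<Sum>d\<in>UNIV. \<Sum>e\<in>UNIV. q $ a $ d * q $ b $ e * P $ a $ b * P $ d $ e)"

text \<open>\<open>\<Delta>g\<close> is the conformal weight of the metric; the weight of $\Phi$ is
  $\Delta^\Phi = \frac{1-D}4\Delta^g$.\<close>

definition weight_phi :: "'d itself \<Rightarrow> real \<Rightarrow> real" where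
  "weight_phi (_ :: 'd itself) \<Delta>g = (1 - real CARD('d)) / 4 * \<Delta>g"

definition conf_generator ::
  "real \<Rightarrow> real \<Rightarrow> real \<Rightarrow> ('m, 'd::finite) spacetime \<Rightarrow> ('m, 'd option) chart \<Rightarrow> real^'d \<Rightarrow> real" where
  "conf_generator \<kappa> lam \<Delta>g M c y = \<Delta>g * Ptr \<kappa> lam M c y
     + weight_phi TYPE('d) \<Delta>g * pi_phi \<kappa> lam M c y * phi_slice M c y"

definition gauge_condition ::
  "real \<Rightarrow> real \<Rightarrow> real \<Rightarrow> real \<Rightarrow> ('m, 'd::finite) spacetime \<Rightarrow> 'm set \<Rightarrow> bool" where
  "gauge_condition \<kappa> lam \<Delta>g \<delta> M \<sigma> \<longleftrightarrow> (\<forall>p\<in>\<sigma>. \<forall>c\<in>slice_charts_at M \<sigma> p.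
     conf_generator \<kappa> lam \<Delta>g M c (spat c p) - sqrt_q M c (spat c p) * \<delta> = 0)"

definition calP ::
  "real \<Rightarrow> real \<Rightarrow> real \<Rightarrow> real \<Rightarrow> real \<Rightarrow> ('m, 'd::finite) spacetime \<Rightarrow> ('m, 'd option) chart
     \<Rightarrow> real^'d \<Rightarrow> real" where
  "calP \<kappa> lam \<Lambda> \<Delta>g \<delta> M c y = (let D = real CARD('d) in
     \<kappa>\<^sup>2 / (2 * det (qmet M c y) * (a_of TYPE('d) \<kappa> lam (phi_slice M c y))\<^sup>2) * Ptf_sq \<kappa> lam M c y
     + (1/2) * scalar_curv (qmet M c) y
     + \<delta>\<^sup>2 * (\<kappa>\<^sup>2 * (D + 1) / (2 * \<Delta>g\<^sup>2 * D * (D - 1)\<^sup>2))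
     - (D + 1) / (D - 1) * \<Lambda>)"


section \<open>The lapse fixing equation\<close>

text \<open>Functions on \<open>\<sigma>\<close> are given by their values on \<open>\<sigma>\<close>; values elsewhere do not matter.\<close>

definition smooth_on_slice :: "('m::topological_space, 'd::finite) spacetime \<Rightarrow> 'm set \<Rightarrow> ('m \<Rightarrow> real) \<Rightarrow> bool" where
  "smooth_on_slice M \<sigma> N \<longleftrightarrow> (\<forall>p\<in>\<sigma>. \<exists>W F. open W \<and> p \<in> W \<and>
     smooth_fun_on (atlas M) W F \<and> (\<forall>r\<in>\<sigma> \<inter> W. F r = N r))"

definition lapse_function :: "('m::topological_space, 'd::finite) spacetime \<Rightarrow> 'm set \<Rightarrow> ('m \<Rightarrow> real) \<Rightarrow> bool" where
  "lapse_function M \<sigma> N \<longleftrightarrow> smooth_on_slice M \<sigma> N \<and> (\<forall>p\<in>slice_boundary M \<sigma>. N p = 0)"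

definition slice_dom :: "'m set \<Rightarrow> ('m, 'd::finite option) chart \<Rightarrow> (real^'d) set" where
  "slice_dom \<sigma> c = spat c ` (\<sigma> \<inter> fst c)"

text \<open>$[D_aD^a - \mathcal P]N$ at the point with slice coordinates \<open>y\<close>.\<close>

definition lapse_op ::
  "real \<Rightarrow> real \<Rightarrow> real \<Rightarrow> real \<Rightarrow> real \<Rightarrow> ('m, 'd::finite) spacetime \<Rightarrow> 'm set
     \<Rightarrow> ('m, 'd option) chart \<Rightarrow> ('m \<Rightarrow> real) \<Rightarrow> real^'d \<Rightarrow> real" where
  "lapse_op \<kappa> lam \<Lambda> \<Delta>g \<delta> M \<sigma> c N y =
     laplacian (qmet M c) (slice_dom \<sigma> c) (\<lambda>z. N (param c (emb z))) y
     - calP \<kappa> lam \<Lambda> \<Delta>g \<delta> M c y * N (param c (emb y))"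

definition solves_lapse_equation ::
  "real \<Rightarrow> real \<Rightarrow> real \<Rightarrow> real \<Rightarrow> real \<Rightarrow> ('m::topological_space, 'd::finite) spacetime \<Rightarrow> 'm set
     \<Rightarrow> ('m \<Rightarrow> real) \<Rightarrow> bool" where
  "solves_lapse_equation \<kappa> lam \<Lambda> \<Delta>g \<delta> M \<sigma> N \<longleftrightarrow> lapse_function M \<sigma> N \<and>
     (\<forall>p\<in>\<sigma>. \<forall>c\<in>slice_charts_at M \<sigma> p. lapse_op \<kappa> lam \<Lambda> \<Delta>g \<delta> M \<sigma> c N (spat c p) = 0)"

text \<open>On the constraint surface,
  $$\{\kappa\mathcal H[N],\mathcal D_\delta[\rho]\}
    = \int_\sigma d^Dx\,\rho\,(D-1)\sqrt q\,\Delta^g\,[D_aD^a-\mathcal P]N .$$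
  The gauge is locally good if the operator paired with $\rho$ has trivial kernel.\<close>

definition bracket_op ::
  "real \<Rightarrow> real \<Rightarrow> real \<Rightarrow> real \<Rightarrow> real \<Rightarrow> ('m, 'd::finite) spacetime \<Rightarrow> 'm set
     \<Rightarrow> ('m, 'd option) chart \<Rightarrow> ('m \<Rightarrow> real) \<Rightarrow> real^'d \<Rightarrow> real" where
  "bracket_op \<kappa> lam \<Lambda> \<Delta>g \<delta> M \<sigma> c N y =
     (real CARD('d) - 1) * sqrt_q M c y * \<Delta>g * lapse_op \<kappa> lam \<Lambda> \<Delta>g \<delta> M \<sigma> c N y"

definition locally_good_gauge_fixing ::
  "real \<Rightarrow> real \<Rightarrow> real \<Rightarrow> real \<Rightarrow> real \<Rightarrow> ('m::topological_space, 'd::finite) spacetime \<Rightarrow> 'm set \<Rightarrow> bool" where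
  "locally_good_gauge_fixing \<kappa> lam \<Lambda> \<Delta>g \<delta> M \<sigma> \<longleftrightarrow>
     (\<forall>N. lapse_function M \<sigma> N \<and>
        (\<forall>p\<in>\<sigma>. \<forall>c\<in>slice_charts_at M \<sigma> p. bracket_op \<kappa> lam \<Lambda> \<Delta>g \<delta> M \<sigma> c N (spat c p) = 0)
        \<longrightarrow> (\<forall>p\<in>\<sigma>. N p = 0))"

end

theory Submission
  imports Defs
begin

text \<open>Projecting the field equation twice on the unit normal and using the doubly contracted Gauss
  equation $2 G_{\mu\nu} n^\mu n^\nu = R^{(D)} + K^2 - K_{ab} K^{ab}$, the weak energy condition
  becomes $R^{(D)} + K^2 - K_{ab} K^{ab} \ge 2 \Lambda$. Since $P^{ab}_{\mathrm{tf}}$ is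
  $\frac1\kappa a \sqrt q$ times the trace-free part of $K^{ab}$, and the gauge condition says
  $K = - \kappa \delta / ((D - 1) \Delta^g)$, inserting this in $\mathcal P$ leaves the claimed lower
  bound plus the squared norm of the trace-free part of $K_{ab}$. If $\mathcal P > 0$, a solution $N$
  cannot attain a nonzero maximum of $|N|$ in the interior of the slice, because there
  $N\, D_a D^a N \le 0 < \mathcal P N^2$.\<close>

section \<open>Calculus of partial derivatives\<close>

text \<open>The obstacle is the Gauss equation in bare coordinates. The induced metric is a block of
  the spacetime metric, but its inverse is not a block of the inverse metric, so
  \<open>christoffel\<close> does not simply restrict to the slice. With lowered indices it does:
  tangential derivatives of tangential components are the same before and after restriction, and the
  inverse metric survives only in the terms quadratic in the first-kind symbols. There g^{-1} =
  q^{-1} - n n accounts for the whole difference, which consists of products of the second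
  fundamental form. The values of \<open>alpha\<close> and \<open>weight_phi\<close> are those for
  which all terms containing the scalar field cancel in \<open>conf_generator\<close>; this is why
  the gauge condition fixes K alone. In the final bound the squared shear appears in two halves, one
  from P_tf and one from the energy inequality. At boundary points derivatives are one-sided. The
  maximum principle never reaches such points, because a nonzero maximum of |N| is not attained
  there; they matter for the converse, that the zero lapse solves the equation.\<close>

lemma partial_eq: "(f has_derivative f') (at x) \<Longrightarrow> partial UNIV i f x = f' (axis i 1)"
  unfolding partial_def using frechet_derivative_at by metis

lemma has_derivative_partial:
  assumes "f differentiable (at x)"
  shows "(f has_derivative (\<lambda>v. \<Sum>i\<in>UNIV. v $ i * partial UNIV i f x)) (at x)"
proof -
  have f: "(f has_derivative frechet_derivative f (at x)) (at x)"
    using assms frechet_derivative_works by blast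
  interpret linear "frechet_derivative f (at x)"
    using f by (rule has_derivative_linear)
  have "frechet_derivative f (at x) v = (\<Sum>i\<in>UNIV. v $ i * partial UNIV i f x)" for v
  proof -
    have "frechet_derivative f (at x) v
        = frechet_derivative f (at x) (\<Sum>i\<in>UNIV. v $ i *\<^sub>R axis i 1)"
      by (simp add: basis_expansion scalar_mult_eq_scaleR[symmetric])
    then show ?thesis
      by (simp add: sum scale partial_def)
  qed
  then show ?thesis using f by presburger
qed

lemma partial_cong_open:
  assumes "open U" "x \<in> U" "\<And>y. y \<in> U \<Longrightarrow> f y = g y"
  shows "partial UNIV i f x = partial UNIV i g x"
proof -
  \<comment> \<open>\<open>frechet_derivative\<close> is a choice among all derivatives, so
    equivalence of the two derivative predicates suffices and differentiability need not be
    assumed.\<close>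
  have "(f has_derivative f') (at x) = (g has_derivative f') (at x)" for f'
    using has_derivative_transform_within_open[of f f' x UNIV U g]
      has_derivative_transform_within_open[of g f' x UNIV U f] assms by metis
  then show ?thesis by (simp add: partial_def frechet_derivative_def)
qed

lemma partial_add:
  assumes "f differentiable (at x)" "g differentiable (at x)"
  shows "partial UNIV i (\<lambda>y. f y + g y) x = partial UNIV i f x + partial UNIV i g x"
  using partial_eq[OF has_derivative_add[OF assms[unfolded frechet_derivative_works]]]
  by (simp add: partial_def)

lemma partial_mult:
  assumes "f differentiable (at x)" "g differentiable (at x)"
  shows "partial UNIV i (\<lambda>y. f y * g y) x = f x * partial UNIV i g x + partial UNIV i f x * g x"
  using partial_eq[OF has_derivative_mult[OF assms[unfolded frechet_derivative_works]]]
  by (simp add: partial_def)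

lemma partial_const: "partial UNIV i (\<lambda>y. c) x = 0"
  by (subst partial_eq[OF has_derivative_const]) simp

lemma partial_sum:
  assumes "\<And>k. k \<in> I \<Longrightarrow> f k differentiable (at x)"
  shows "partial UNIV i (\<lambda>y. \<Sum>k\<in>I. f k y) x = (\<Sum>k\<in>I. partial UNIV i (f k) x)"
proof -
  have "((\<lambda>y. \<Sum>k\<in>I. f k y) has_derivative (\<lambda>v. \<Sum>k\<in>I. frechet_derivative (f k) (at x) v)) (at x)"
    by (rule has_derivative_sum) (use assms frechet_derivative_works in blast)
  from partial_eq[OF this] show ?thesis by (simp add: partial_def)
qed

lemma partial_compose_linear:
  fixes L :: "real^'a::finite \<Rightarrow> real^'b::finite"
  assumes "linear L" "f differentiable (at (L y))" "L (axis a 1) = axis b 1"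
  shows "partial UNIV a (\<lambda>z. f (L z)) y = partial UNIV b f (L y)"
proof -
  have L: "(L has_derivative L) (at y)"
    using assms(1) linear_conv_bounded_linear bounded_linear_imp_has_derivative by blast
  have "((\<lambda>z. f (L z)) has_derivative (\<lambda>v. frechet_derivative f (at (L y)) (L v))) (at y)"
    by (rule has_derivative_compose[OF L]) (use assms(2) frechet_derivative_works in blast)
  from partial_eq[OF this] show ?thesis by (simp add: partial_def assms(3))
qed

lemma differentiable_compose_linear:
  fixes L :: "real^'a::finite \<Rightarrow> real^'b::finite" and f :: "real^'b \<Rightarrow> real"
  assumes "linear L" "f differentiable (at (L y))"
  shows "(\<lambda>z. f (L z)) differentiable (at y)"
proof -
  have "L differentiable (at y)"
    using assms(1) linear_imp_differentiable by blast
  then show ?thesis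
    using differentiable_compose[of f L y UNIV] assms(2) by simp
qed

lemma smooth_on_differentiable: "smooth_on U f \<Longrightarrow> x \<in> U \<Longrightarrow> f differentiable (at x)"
  unfolding smooth_on_def using Ck_on.simps(2)[of 0 U f] by blast

lemma smooth_on_partial: "smooth_on U f \<Longrightarrow> smooth_on U (partial UNIV i f)"
  unfolding smooth_on_def using Ck_on.simps(2) by blast

lemma smooth_on_continuous: "smooth_on U f \<Longrightarrow> continuous_on U f"
  unfolding smooth_on_def using Ck_on.simps(1) by blast

lemma line_derivative:
  assumes "f differentiable (at (x + t *\<^sub>R v))"
  shows "((\<lambda>s. f (x + s *\<^sub>R v)) has_real_derivative
    (\<Sum>i\<in>UNIV. v $ i * partial UNIV i f (x + t *\<^sub>R v))) (at t)"
proof -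
  have 1: "((\<lambda>s. x + s *\<^sub>R v) has_derivative (\<lambda>s. s *\<^sub>R v)) (at t)"
    by (auto intro!: derivative_eq_intros)
  show ?thesis
    unfolding has_field_derivative_def
    by (rule has_derivative_eq_rhs[OF has_derivative_compose[OF 1 has_derivative_partial[OF assms]]])
       (simp add: sum_distrib_left fun_eq_iff mult_ac)
qed

lemma line_derivative_axis:
  assumes "f differentiable (at (x + t *\<^sub>R axis i 1))"
  shows "((\<lambda>s. f (x + s *\<^sub>R axis i 1)) has_real_derivative
    partial UNIV i f (x + t *\<^sub>R axis i 1)) (at t)"
proof -
  have "(\<Sum>j\<in>UNIV. (axis i 1 :: real^_) $ j * c j) = c i" for c :: "_ \<Rightarrow> real"
    by (simp add: axis_def if_distrib[where f="\<lambda>z. z * _"] cong: if_cong)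
  with line_derivative[OF assms] show ?thesis by simp
qed

text \<open>Mean value theorem twice: in direction i for the increment in direction j, then in
  direction j for the first partial derivative. The left-hand side of the equation is symmetric in i
  and j, which is what \<open>partial_commute\<close> exploits.\<close>

lemma second_difference:
  fixes f :: "real^'n::finite \<Rightarrow> real"
  assumes f: "smooth_on U f" and h: "h > 0"
    and U: "\<And>s t. 0 \<le> s \<Longrightarrow> s \<le> h \<Longrightarrow> 0 \<le> t \<Longrightarrow> t \<le> h \<Longrightarrow> x + s *\<^sub>R axis i 1 + t *\<^sub>R axis j 1 \<in> U"
  shows "\<exists>s t. 0 < s \<and> s < h \<and> 0 < t \<and> t < h \<and>
    f (x + h *\<^sub>R axis i 1 + h *\<^sub>R axis j 1) - f (x + h *\<^sub>R axis i 1) - f (x + h *\<^sub>R axis j 1) + f x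
    = h * h * partial UNIV j (partial UNIV i f) (x + s *\<^sub>R axis i 1 + t *\<^sub>R axis j 1)"
proof -
  define u :: "real^'n" where "u = axis i 1"
  define v :: "real^'n" where "v = axis j 1"
  note U = U[folded u_def v_def]
  define g where "g s = f (x + h *\<^sub>R v + s *\<^sub>R u) - f (x + s *\<^sub>R u)" for s
  define g' where "g' s = partial UNIV i f (x + h *\<^sub>R v + s *\<^sub>R u) - partial UNIV i f (x + s *\<^sub>R u)" for s
  have "(g has_real_derivative g' s) (at s)" if "0 \<le> s" "s \<le> h" for s
    unfolding g_def g'_def u_def
    using U[of s h] U[of s 0] that h
    by (intro DERIV_diff line_derivative_axis smooth_on_differentiable[OF f])
       (simp_all add: u_def add_ac)
  then obtain s where s: "0 < s" "s < h" "g h - g 0 = h * g' s"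
    using MVT2[of 0 h g g'] h by auto
  have "((\<lambda>t. partial UNIV i f (x + s *\<^sub>R u + t *\<^sub>R v)) has_real_derivative
      partial UNIV j (partial UNIV i f) (x + s *\<^sub>R u + t *\<^sub>R v)) (at t)" if "0 \<le> t" "t \<le> h" for t
    unfolding v_def
    by (rule line_derivative_axis, rule smooth_on_differentiable[OF smooth_on_partial[OF f]])
       (use U[of s t] that s in \<open>simp add: v_def\<close>)
  then obtain t where t: "0 < t" "t < h"
    "partial UNIV i f (x + s *\<^sub>R u + h *\<^sub>R v) - partial UNIV i f (x + s *\<^sub>R u + 0 *\<^sub>R v)
      = (h - 0) * partial UNIV j (partial UNIV i f) (x + s *\<^sub>R u + t *\<^sub>R v)"
    using MVT2[OF h, of "\<lambda>t. partial UNIV i f (x + s *\<^sub>R u + t *\<^sub>R v)"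
        "\<lambda>t. partial UNIV j (partial UNIV i f) (x + s *\<^sub>R u + t *\<^sub>R v)"] by auto
  have "g' s = h * partial UNIV j (partial UNIV i f) (x + s *\<^sub>R u + t *\<^sub>R v)"
    using t(3) by (simp add: g'_def add_ac)
  with s(3) have "f (x + h *\<^sub>R u + h *\<^sub>R v) - f (x + h *\<^sub>R u) - f (x + h *\<^sub>R v) + f x
      = h * h * partial UNIV j (partial UNIV i f) (x + s *\<^sub>R u + t *\<^sub>R v)"
    by (simp add: g_def add_ac)
  with s t show ?thesis
    unfolding u_def v_def by blast
qed

text \<open>Both mixed derivatives, each at some point near x, equal the same second difference
  divided by h * h. By continuity a gap between them at x is impossible.\<close>

lemma partial_commute:
  fixes f :: "real^'n::finite \<Rightarrow> real"
  assumes f: "smooth_on U f" and U: "open U" "x \<in> U"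
  shows "partial UNIV i (partial UNIV j f) x = partial UNIV j (partial UNIV i f) x"
proof (rule ccontr)
  define A where "A = partial UNIV i (partial UNIV j f)"
  define B where "B = partial UNIV j (partial UNIV i f)"
  assume "partial UNIV i (partial UNIV j f) x \<noteq> partial UNIV j (partial UNIV i f) x"
  then have "A x \<noteq> B x" by (simp add: A_def B_def)
  define e where "e = \<bar>A x - B x\<bar> / 2"
  have e: "e > 0" using \<open>A x \<noteq> B x\<close> by (simp add: e_def)
  have cont: "isCont A x" "isCont B x"
    using smooth_on_continuous[OF smooth_on_partial[OF smooth_on_partial[OF f]]] U
    by (simp_all add: A_def B_def continuous_on_eq_continuous_at)
  obtain r where r: "r > 0" "ball x r \<subseteq> U" using U open_contains_ball by blast
  have near_val: "\<exists>d>0. \<forall>y. dist y x < d \<longrightarrow> dist (C y) (C x) < e" if "isCont C x" for C :: "real^'n \<Rightarrow> real"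
  proof -
    have "eventually (\<lambda>y. dist (C y) (C x) < e) (at x)"
      using that e by (simp add: isCont_def tendstoD)
    then obtain d where "d > 0" "\<forall>y. y \<noteq> x \<and> dist y x < d \<longrightarrow> dist (C y) (C x) < e"
      by (auto simp: eventually_at)
    with e show ?thesis by (metis dist_self)
  qed
  obtain d1 where d1: "d1 > 0" "\<And>y. dist y x < d1 \<Longrightarrow> dist (A y) (A x) < e"
    using near_val[OF cont(1)] by blast
  obtain d2 where d2: "d2 > 0" "\<And>y. dist y x < d2 \<Longrightarrow> dist (B y) (B x) < e"
    using near_val[OF cont(2)] by blast
  \<comment> \<open>Two axis steps of length at most h move the point by at most 2 * h; dividing by
    3 keeps this strictly below every radius.\<close>
  define h where "h = min r (min d1 d2) / 3"
  have h: "h > 0" "2 * h < r" "2 * h < d1" "2 * h < d2" using r d1 d2 by (auto simp: h_def)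
  have near: "dist (x + s *\<^sub>R axis k 1 + t *\<^sub>R axis l 1) x \<le> 2 * h"
    if "0 \<le> s" "s \<le> h" "0 \<le> t" "t \<le> h" for s t and k l :: 'n
    using norm_triangle_ineq[of "s *\<^sub>R axis k 1" "t *\<^sub>R (axis l 1 :: real^'n)"] that
    by (simp add: dist_norm algebra_simps)
  have inU: "x + s *\<^sub>R axis k 1 + t *\<^sub>R axis l 1 \<in> U"
    if "0 \<le> s" "s \<le> h" "0 \<le> t" "t \<le> h" for s t and k l :: 'n
    using near[OF that, of k l] h r by (auto simp: dist_commute)
  obtain s t where st: "0 < s" "s < h" "0 < t" "t < h"
    "f (x + h *\<^sub>R axis i 1 + h *\<^sub>R axis j 1) - f (x + h *\<^sub>R axis i 1) - f (x + h *\<^sub>R axis j 1) + f x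
      = h * h * B (x + s *\<^sub>R axis i 1 + t *\<^sub>R axis j 1)"
    using second_difference[OF f h(1) inU, of i j] unfolding B_def by auto
  obtain s' t' where st': "0 < s'" "s' < h" "0 < t'" "t' < h"
    "f (x + h *\<^sub>R axis j 1 + h *\<^sub>R axis i 1) - f (x + h *\<^sub>R axis j 1) - f (x + h *\<^sub>R axis i 1) + f x
      = h * h * A (x + s' *\<^sub>R axis j 1 + t' *\<^sub>R axis i 1)"
    using second_difference[OF f h(1) inU, of j i] unfolding A_def by auto
  have "h * h * A (x + s' *\<^sub>R axis j 1 + t' *\<^sub>R axis i 1) = h * h * B (x + s *\<^sub>R axis i 1 + t *\<^sub>R axis j 1)"
    using st(5) st'(5) add.commute[of "h *\<^sub>R axis j 1" "h *\<^sub>R axis i (1::real)"]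
    by (simp only: add.assoc)
  then have "A (x + s' *\<^sub>R axis j 1 + t' *\<^sub>R axis i 1) = B (x + s *\<^sub>R axis i 1 + t *\<^sub>R axis j 1)"
    using h(1) by simp
  moreover have "dist (A (x + s' *\<^sub>R axis j 1 + t' *\<^sub>R axis i 1)) (A x) < e"
    using near[of s' t' j i] st' h by (intro d1) auto
  moreover have "dist (B (x + s *\<^sub>R axis i 1 + t *\<^sub>R axis j 1)) (B x) < e"
    using near[of s t i j] st h by (intro d2) auto
  ultimately have "\<bar>A x - B x\<bar> < 2 * e" by (auto simp: dist_real_def)
  then show False by (simp add: e_def)
qed

section \<open>Matrices and quadratic forms\<close>

lemma bil_sum: "bil G v w = (\<Sum>i\<in>UNIV. \<Sum>j\<in>UNIV. v $ i * G $ i $ j * w $ j)"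
  by (simp add: bil_def inner_vec_def matrix_vector_mult_def sum_distrib_left mult.assoc)

lemma symmetric_entry: "transpose A = A \<Longrightarrow> A $ i $ j = A $ j $ i"
  by (metis transpose_def vec_lambda_beta)

lemma bil_commute:
  assumes "transpose G = G"
  shows "bil G v w = bil G w v"
  unfolding bil_sum
  by (subst sum.swap) (simp add: symmetric_entry[OF assms] mult_ac)

lemma bil_add_left: "bil G (u + v) w = bil G u w + bil G v w"
  and bil_add_right: "bil G w (u + v) = bil G w u + bil G w v"
  and bil_scale_left: "bil G (c *\<^sub>R v) w = c * bil G v w"
  and bil_scale_right: "bil G v (c *\<^sub>R w) = c * bil G v w"
  by (simp_all add: bil_def inner_add_left inner_add_right matrix_vector_right_distrib
      matrix_vector_mult_scaleR)

lemma bil_sum_left: "bil G (\<Sum>i\<in>I. f i) w = (\<Sum>i\<in>I. bil G (f i) w)"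
  and bil_sum_right: "bil G w (\<Sum>i\<in>I. f i) = (\<Sum>i\<in>I. bil G w (f i))"
  by (simp_all add: bil_def inner_sum_left inner_sum_right linear_sum[OF matrix_vector_mul_linear])

lemma bil_zero_left [simp]: "bil G 0 w = 0"
  by (simp add: bil_def)

lemma bil_axis_left: "bil G (axis i 1) w = (G *v w) $ i"
  by (simp add: bil_def inner_axis')

lemma bil_axis: "bil G (axis i 1) (axis j 1) = G $ i $ j"
  by (simp add: bil_axis_left matrix_vector_mul_component inner_axis)

lemma bil_Cauchy_Schwarz:
  assumes sym: "transpose A = A" and psd: "\<And>v. bil A v v \<ge> 0"
  shows "(bil A v w)\<^sup>2 \<le> bil A v v * bil A w w"
proof -
  define a b c where "a = bil A v v" and "b = bil A v w" and "c = bil A w w"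
  have quad: "a * t\<^sup>2 + 2 * t * b + c \<ge> 0" for t
    using psd[of "t *\<^sub>R v + w"] bil_commute[OF sym, of w v]
    by (simp add: bil_add_left bil_add_right bil_scale_left bil_scale_right a_def b_def c_def
        power2_eq_square algebra_simps)
  have "a \<ge> 0" using psd by (simp add: a_def)
  have "b\<^sup>2 \<le> a * c"
  proof (cases "a = 0")
    case True
    have "b = 0"
    proof (rule ccontr)
      assume "b \<noteq> 0"
      then show False
        \<comment> \<open>At this t the linear function 2 * t * b + c takes the value -1.\<close>
        using quad[of "- (c + 1) / (2 * b)"] by (simp add: True field_simps)
    qed
    with True show ?thesis by simp
  next
    case False
    \<comment> \<open>The minimiser of the quadratic.\<close>
    with \<open>a \<ge> 0\<close> quad[of "- b / a"] show ?thesis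
      by (simp add: power2_eq_square field_simps)
  qed
  then show ?thesis by (simp add: a_def b_def c_def)
qed

text \<open>Successive elimination of rows by Schur complements.\<close>

lemma psd_supported_decomposition:
  fixes A :: "real^'n::finite^'n"
  assumes "finite S" "transpose A = A" "\<And>v. bil A v v \<ge> 0" "\<And>i j. i \<notin> S \<Longrightarrow> A $ i $ j = 0"
  shows "\<exists>B :: 'n \<Rightarrow> real^'n. \<forall>i j. A $ i $ j = (\<Sum>k\<in>S. B k $ i * B k $ j)"
  using assms
proof (induction S arbitrary: A rule: finite_induct)
  case empty
  then show ?case by auto
next
  case (insert s S)
  define a where "a = A $ s $ s"
  \<comment> \<open>If a = 0, division by zero makes v zero, so nothing is subtracted.
    Cauchy-Schwarz then shows that row s was already zero.\<close>
  define v :: "real^'n" where "v = (\<chi> i. A $ s $ i / sqrt a)"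
  define A' :: "real^'n^'n" where "A' = (\<chi> i j. A $ i $ j - v $ i * v $ j)"
  note sym = symmetric_entry[OF insert.prems(1)]
  have a: "a \<ge> 0" using insert.prems(2)[of "axis s 1"] by (simp add: bil_axis a_def)
  have vv: "v $ i * v $ j = A $ s $ i * A $ s $ j / a" for i j
    using a by (simp add: v_def)
  have "transpose A' = A'"
    by (simp add: A'_def transpose_def vec_eq_iff mult.commute sym)
  moreover have "bil A' w w \<ge> 0" for w
  proof -
    have "bil A' w w = bil A w w - (\<Sum>i\<in>UNIV. v $ i * w $ i)\<^sup>2"
      by (simp add: bil_sum A'_def power2_eq_square sum_product algebra_simps sum_subtractf)
    also have "(\<Sum>i\<in>UNIV. v $ i * w $ i) = bil A (axis s 1) w / sqrt a"
      by (simp add: bil_axis_left matrix_vector_mult_def v_def sum_divide_distrib)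
    also have "(bil A (axis s 1) w / sqrt a)\<^sup>2 = (bil A (axis s 1) w)\<^sup>2 / a"
      using a by (simp add: power_divide)
    finally have eq: "bil A' w w = bil A w w - (bil A (axis s 1) w)\<^sup>2 / a" .
    have "(bil A (axis s 1) w)\<^sup>2 \<le> a * bil A w w"
      using bil_Cauchy_Schwarz[OF insert.prems(1,2), of "axis s 1" w] by (simp add: bil_axis a_def)
    then have "(bil A (axis s 1) w)\<^sup>2 / a \<le> bil A w w"
      using a insert.prems(2)[of w] by (cases "a = 0") (simp_all add: field_simps)
    with eq show ?thesis by simp
  qed
  moreover have "A' $ i $ j = 0" if "i \<notin> S" for i j
  proof (cases "i = s")
    case True
    have "(A $ s $ j)\<^sup>2 \<le> a * A $ j $ j"
      using bil_Cauchy_Schwarz[OF insert.prems(1,2), of "axis s 1" "axis j 1"]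
      by (simp add: bil_axis a_def)
    then show ?thesis by (cases "a = 0") (simp_all add: True A'_def vv, simp add: a_def)
  next
    case False
    with that have "A $ i $ j = 0" "A $ s $ i = 0"
      using insert.prems(3)[of i] sym[of s i] by auto
    then show ?thesis by (simp add: A'_def vv)
  qed
  ultimately obtain B where B: "\<And>i j. A' $ i $ j = (\<Sum>k\<in>S. B k $ i * B k $ j)"
    using insert.IH[of A'] by blast
  have "A $ i $ j = (\<Sum>k\<in>insert s S. (B(s := v)) k $ i * (B(s := v)) k $ j)" for i j
  proof -
    have "(\<Sum>k\<in>S. (B(s := v)) k $ i * (B(s := v)) k $ j) = (\<Sum>k\<in>S. B k $ i * B k $ j)"
      using insert.hyps by (intro sum.cong) auto
    then show ?thesis using insert.hyps B[of i j] by (simp add: A'_def)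
  qed
  then show ?case by blast
qed

lemma psd_decomposition:
  fixes A :: "real^'n::finite^'n"
  assumes "transpose A = A" "\<And>v. bil A v v \<ge> 0"
  obtains B :: "'n \<Rightarrow> real^'n" where "\<And>i j. A $ i $ j = (\<Sum>k\<in>UNIV. B k $ i * B k $ j)"
  using psd_supported_decomposition[of UNIV A] assms by auto

text \<open>Writing A as a sum of squares turns the contraction into a sum of values of the
  quadratic form H, with no diagonalisation and no symmetry of H. It serves both for the Laplacian
  at a maximum and for the sign of the squared shear.\<close>

lemma psd_contract_nonpos:
  fixes A :: "real^'n::finite^'n"
  assumes "transpose A = A" "\<And>v. bil A v v \<ge> 0" "\<And>v. bil H v v \<le> 0"
  shows "(\<Sum>i\<in>UNIV. \<Sum>j\<in>UNIV. A $ i $ j * H $ i $ j) \<le> 0"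
proof -
  obtain B :: "'n \<Rightarrow> real^'n" where B: "\<And>i j. A $ i $ j = (\<Sum>k\<in>UNIV. B k $ i * B k $ j)"
    using psd_decomposition[OF assms(1,2)] by blast
  have "(\<Sum>i\<in>UNIV. \<Sum>j\<in>UNIV. A $ i $ j * H $ i $ j)
      = (\<Sum>i\<in>UNIV. \<Sum>j\<in>UNIV. \<Sum>k\<in>UNIV. B k $ i * H $ i $ j * B k $ j)"
    by (simp add: B sum_distrib_left mult_ac)
  also have "\<dots> = (\<Sum>i\<in>UNIV. \<Sum>k\<in>UNIV. \<Sum>j\<in>UNIV. B k $ i * H $ i $ j * B k $ j)"
    by (rule sum.cong[OF refl], rule sum.swap)
  also have "\<dots> = (\<Sum>k\<in>UNIV. bil H (B k) (B k))"
    unfolding bil_sum by (rule sum.swap)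
  also have "\<dots> \<le> 0" by (rule sum_nonpos) (simp add: assms(3))
  finally show ?thesis .
qed

text \<open>Contracting b with e first leaves the Gram matrix of the rows of X with respect to A,
  which is positive semidefinite; its negative is the H of
  \<open>psd_contract_nonpos\<close>.\<close>

lemma psd_contract_square_nonneg:
  fixes A X :: "real^'n::finite^'n"
  assumes "transpose A = A" "\<And>v. bil A v v \<ge> 0"
  shows "0 \<le> (\<Sum>a\<in>UNIV. \<Sum>b\<in>UNIV. \<Sum>d\<in>UNIV. \<Sum>e\<in>UNIV.
    A $ a $ d * A $ b $ e * X $ a $ b * X $ d $ e)"
proof -
  define H :: "real^'n^'n" where "H = (\<chi> a d. - bil A (X $ a) (X $ d))"
  have "bil H v v = - bil A (\<Sum>a\<in>UNIV. v $ a *\<^sub>R X $ a) (\<Sum>d\<in>UNIV. v $ d *\<^sub>R X $ d)" for v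
    unfolding bil_sum[of H] bil_sum_left bil_sum_right
    by (subst sum.swap) (simp add: H_def bil_scale_left bil_scale_right sum_negf mult_ac sum_distrib_left)
  then have "bil H v v \<le> 0" for v
    using assms(2) by simp
  then have "(\<Sum>a\<in>UNIV. \<Sum>d\<in>UNIV. A $ a $ d * H $ a $ d) \<le> 0"
    by (rule psd_contract_nonpos[OF assms])
  moreover have "(\<Sum>a\<in>UNIV. \<Sum>d\<in>UNIV. A $ a $ d * H $ a $ d)
    = - (\<Sum>a\<in>UNIV. \<Sum>d\<in>UNIV. \<Sum>b\<in>UNIV. \<Sum>e\<in>UNIV.
        A $ a $ d * A $ b $ e * X $ a $ b * X $ d $ e)"
    by (simp add: H_def bil_sum sum_negf sum_distrib_left mult_ac)
  moreover have "(\<Sum>a\<in>UNIV. \<Sum>d\<in>UNIV. \<Sum>b\<in>UNIV. \<Sum>e\<in>UNIV.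
        A $ a $ d * A $ b $ e * X $ a $ b * X $ d $ e)
    = (\<Sum>a\<in>UNIV. \<Sum>b\<in>UNIV. \<Sum>d\<in>UNIV. \<Sum>e\<in>UNIV.
        A $ a $ d * A $ b $ e * X $ a $ b * X $ d $ e)"
    by (rule sum.cong[OF refl], rule sum.swap)
  ultimately show ?thesis by linarith
qed

section \<open>Inverses and determinants of positive definite matrices\<close>

lemma matrix_inv_right: "invertible A \<Longrightarrow> A ** matrix_inv A = mat 1"
  and matrix_inv_left: "invertible A \<Longrightarrow> matrix_inv A ** A = mat 1"
  unfolding invertible_def matrix_inv_def
  by (metis (mono_tags, lifting) someI_ex)+

lemma matrix_inv_unique:
  fixes A B :: "real^'n::finite^'n"
  assumes "A ** B = mat 1"
  shows "matrix_inv A = B"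
proof -
  have "invertible A" using assms invertible_right_inverse by blast
  then show ?thesis
    by (metis assms matrix_inv_left matrix_mul_assoc matrix_mul_lid matrix_mul_rid)
qed

lemma matrix_inv_right_sum:
  "invertible A \<Longrightarrow> (\<Sum>k\<in>UNIV. A $ i $ k * matrix_inv A $ k $ j) = (if i = j then 1 else 0)"
  using matrix_inv_right[of A] by (simp add: matrix_matrix_mult_def mat_def vec_eq_iff)

lemma matrix_inv_left_sum:
  "invertible A \<Longrightarrow> (\<Sum>k\<in>UNIV. matrix_inv A $ i $ k * A $ k $ j) = (if i = j then 1 else 0)"
  using matrix_inv_left[of A] by (simp add: matrix_matrix_mult_def mat_def vec_eq_iff)

lemma transpose_matrix_inv:
  fixes A :: "real^'n::finite^'n"
  assumes "transpose A = A" "invertible A"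
  shows "transpose (matrix_inv A) = matrix_inv A"
proof -
  have "A ** transpose (matrix_inv A) = transpose (matrix_inv A ** A)"
    by (simp add: matrix_transpose_mul assms(1))
  then have "A ** transpose (matrix_inv A) = mat 1"
    by (simp add: matrix_inv_left assms(2))
  then show ?thesis using matrix_inv_unique by metis
qed

lemma pos_def_invertible:
  fixes q :: "real^'n::finite^'n"
  assumes "\<And>v. v \<noteq> 0 \<Longrightarrow> bil q v v > 0"
  shows "invertible q"
proof -
  have "x = 0" if "q *v x = 0" for x
    using assms[of x] that by (auto simp: bil_def)
  then show ?thesis
    by (meson invertible_left_inverse matrix_left_invertible_ker)
qed

lemma pos_def_det_pos:
  fixes q :: "real^'n::finite^'n"
  assumes "transpose q = q" "\<And>v. v \<noteq> 0 \<Longrightarrow> bil q v v > 0"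
  shows "det q > 0"
proof -
  have "bil q v v \<ge> 0" for v
    using assms(2)[of v] by (cases "v = 0") auto
  then obtain B :: "'n \<Rightarrow> real^'n" where B: "\<And>i j. q $ i $ j = (\<Sum>k\<in>UNIV. B k $ i * B k $ j)"
    using psd_decomposition[OF assms(1)] by blast
  \<comment> \<open>The squares of the decomposition become the rows of C, so that q is the Gram
    matrix of C and its determinant is a square.\<close>
  define C :: "real^'n^'n" where "C = (\<chi> k. B k)"
  have "q = transpose C ** C"
    by (simp add: vec_eq_iff B C_def matrix_matrix_mult_def transpose_def)
  then have "det q = (det C)\<^sup>2"
    by (simp add: det_mul power2_eq_square)
  moreover have "det q \<noteq> 0"
    using pos_def_invertible[OF assms(2)] invertible_det_nz by blast
  ultimately show ?thesis by simp
qed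

lemma pos_def_matrix_inv_psd:
  fixes q :: "real^'n::finite^'n"
  assumes sym: "transpose q = q" and pos: "\<And>v. v \<noteq> 0 \<Longrightarrow> bil q v v > 0"
  shows "bil (matrix_inv q) v v \<ge> 0"
proof -
  have inv: "invertible q" using pos by (rule pos_def_invertible)
  define u where "u = matrix_inv q *v v"
  have "q *v u = v"
    by (simp add: u_def matrix_vector_mul_assoc matrix_inv_right[OF inv])
  then have "bil (matrix_inv q) v v = bil q u u"
    by (simp add: bil_def u_def inner_commute)
  then show ?thesis using pos[of u] by (cases "u = 0") auto
qed

section \<open>Slice coordinates inside spacetime coordinates\<close>

lemma sum_UNIV_option: "(\<Sum>i\<in>(UNIV :: 'd::finite option set). f i) = f None + (\<Sum>a\<in>UNIV. f (Some a))"
  by (simp add: UNIV_option_conv sum.reindex)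

lemma emb_nth [simp]: "emb y $ None = 0" "emb y $ Some a = y $ a"
  by (simp_all add: emb_def)

lemma emb_axis: "emb (axis a 1) = axis (Some a) 1"
  by (simp add: vec_eq_iff emb_def axis_def split: option.split)

lemma linear_emb: "linear emb"
  by (auto intro!: linearI simp: vec_eq_iff emb_def split: option.split)

section \<open>Unit normals of spacelike hyperplanes\<close>

definition spatial_block :: "real^('d::finite option)^('d option) \<Rightarrow> real^'d^'d" where
  "spatial_block G = (\<chi> a b. G $ Some a $ Some b)"

lemma bil_emb: "bil G (emb u) (emb v) = bil (spatial_block G) u v"
  by (simp add: bil_sum sum_UNIV_option spatial_block_def)

lemma emb_of_spatial: "v $ None = 0 \<Longrightarrow> v = emb (\<chi> a. v $ Some a)"
  by (simp add: vec_eq_iff emb_def split: option.split)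

text \<open>The Lorentzian signature enters as one timelike vector \<open>o_vec\<close>, the time
  orientation at the point. Together with the positive definite spatial block it determines the sign
  of the direction transverse to the hyperplane.\<close>

locale spacelike_split =
  fixes G :: "real^('d::finite option)^('d option)" and o_vec :: "real^('d option)"
  assumes sym: "transpose G = G" and inv: "invertible G"
    and timelike: "bil G o_vec o_vec < 0"
    and pos: "\<And>v. v \<noteq> 0 \<Longrightarrow> bil (spatial_block G) v v > 0"
begin

text \<open>The gradient of the coordinate \<open>None\<close>, with its index raised. It is
  orthogonal to the hyperplane, and every normal is a multiple of it.\<close>

definition w :: "real^('d option)" where "w = matrix_inv G *v axis None 1"

lemma G_w: "G *v w = axis None 1"
  by (simp add: w_def matrix_vector_mul_assoc matrix_inv_right[OF inv])

lemma bil_w: "bil G v w = v $ None"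
  by (simp add: bil_def G_w inner_axis)

lemma spatial_nonneg:
  assumes "v $ None = 0"
  shows "bil G v v \<ge> 0"
proof -
  define u where "u = (\<chi> a. v $ Some a)"
  have "v = emb u" using emb_of_spatial[OF assms] by (simp add: u_def)
  then have "bil G v v = bil (spatial_block G) u u" using bil_emb by metis
  then show ?thesis using pos[of u] by (cases "u = 0") auto
qed

lemma w_None_neq: "w $ None \<noteq> 0"
proof
  assume w0: "w $ None = 0"
  define u where "u = (\<chi> a. w $ Some a)"
  have wu: "w = emb u" using emb_of_spatial[OF w0] by (simp add: u_def)
  have "bil (spatial_block G) u u = 0"
    using bil_w[of w] w0 bil_emb[of G u u] by (simp add: wu)
  then have "u = 0" using pos[of u] by (cases "u = 0") auto
  then have "w = 0" by (simp add: wu linear_0[OF linear_emb])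
  then have "(axis None 1 :: real^('d option)) = 0" using G_w by simp
  then show False by simp
qed

text \<open>By \<open>bil_w\<close> this number is the square of w. Split \<open>o_vec\<close>
  orthogonally into a vector in the hyperplane and a multiple of w: the first part has nonnegative
  square, so the negative square of \<open>o_vec\<close> must come from w.\<close>

lemma w_None_neg: "w $ None < 0"
proof -
  define s where "s = o_vec $ None / w $ None"
  define v where "v = o_vec - s *\<^sub>R w"
  have v0: "v $ None = 0" using w_None_neq by (simp add: v_def s_def)
  have "o_vec = v + s *\<^sub>R w" by (simp add: v_def)
  then have "bil G o_vec o_vec = bil G v v + s * s * w $ None"
    using bil_commute[OF sym, of w v]
    by (simp add: bil_add_left bil_add_right bil_scale_left bil_scale_right bil_w v0)
  then have "s * s * w $ None < 0" using timelike spatial_nonneg[OF v0] by linarith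
  then show ?thesis by (auto simp: mult_less_0_iff)
qed

lemma o_None_neq: "o_vec $ None \<noteq> 0"
  using spatial_nonneg[of o_vec] timelike by fastforce

lemma normal_direction:
  assumes "\<And>a. bil G n (axis (Some a) 1) = 0"
  shows "G *v n = (G *v n) $ None *\<^sub>R axis None 1" and "n = (G *v n) $ None *\<^sub>R w"
proof -
  have "(G *v n) $ Some a = 0" for a
    using assms[of a] bil_commute[OF sym, of n "axis (Some a) 1"] by (simp add: bil_axis_left)
  then have "\<forall>i. (G *v n) $ i = ((G *v n) $ None *\<^sub>R axis None 1) $ i"
    by (intro allI, case_tac i) (simp_all add: axis_def)
  then show 1: "G *v n = (G *v n) $ None *\<^sub>R axis None 1"
    by (rule iffD2[OF vec_eq_iff])
  have "matrix_inv G *v (G *v n) = (G *v n) $ None *\<^sub>R w"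
    by (subst 1) (simp add: w_def matrix_vector_mult_scaleR)
  then show "n = (G *v n) $ None *\<^sub>R w"
    by (simp add: matrix_vector_mul_assoc matrix_inv_left[OF inv])
qed

lemma ex1_unit_normal:
  "\<exists>!n. bil G n n = - 1 \<and> (\<forall>a. bil G n (axis (Some a) 1) = 0) \<and> bil G o_vec n < 0"
proof (rule ex1I)
  \<comment> \<open>The modulus normalises w to square -1. The sign makes the vector future
    pointing, since the product of \<open>o_vec\<close> with w is
    \<open>o_vec $ None\<close>.\<close>
  define t where "t = - sgn (o_vec $ None) / sqrt (- (w $ None))"
  have tt: "t * t * w $ None = - 1"
    using w_None_neg o_None_neq by (simp add: t_def sgn_if real_sqrt_mult_self field_simps)
  have to: "t * o_vec $ None < 0"
    using w_None_neg o_None_neq by (simp add: t_def sgn_if field_simps)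
  show "bil G (t *\<^sub>R w) (t *\<^sub>R w) = - 1 \<and> (\<forall>a. bil G (t *\<^sub>R w) (axis (Some a) 1) = 0)
      \<and> bil G o_vec (t *\<^sub>R w) < 0"
    using tt to bil_commute[OF sym, of w]
    by (simp add: bil_scale_left bil_scale_right bil_w axis_def mult.assoc)
  fix n
  assume n: "bil G n n = - 1 \<and> (\<forall>a. bil G n (axis (Some a) 1) = 0) \<and> bil G o_vec n < 0"
  define s where "s = (G *v n) $ None"
  have ns: "n = s *\<^sub>R w" using normal_direction(2)[of n] n by (simp add: s_def)
  have "s * s * w $ None = - 1" "s * o_vec $ None < 0"
    using n by (simp_all add: ns bil_scale_left bil_scale_right bil_w mult.assoc)
  then have "s * s * w $ None = t * t * w $ None" "s * o_vec $ None < 0"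
    using tt by simp_all
  then have "s * s = t * t" "s * o_vec $ None < 0"
    using w_None_neq by simp_all
  then have "s = t" using to by (auto simp: square_eq_iff)
  then show "n = t *\<^sub>R w" using ns by simp
qed

text \<open>The completeness relation g^{-1} = q^{-1} - n n, with q^{-1} padded by zeros in the
  index \<open>None\<close>. It is verified by multiplying with G; the mixed entries in row
  \<open>None\<close> require the spatial components of n.\<close>

lemma matrix_inv_split:
  assumes norm: "bil G n n = - 1" and orth: "\<And>a. bil G n (axis (Some a) 1) = 0"
  shows "matrix_inv G $ i $ j =
    (case (i, j) of (Some a, Some b) \<Rightarrow> matrix_inv (spatial_block G) $ a $ b | _ \<Rightarrow> 0) - n $ i * n $ j"
proof -
  define q where "q = spatial_block G"
  define t where "t = (G *v n) $ None"
  have q: "q $ a $ b = G $ Some a $ Some b" for a b by (simp add: q_def spatial_block_def)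
  have qsym: "transpose q = q"
    using symmetric_entry[OF sym] by (simp add: vec_eq_iff q transpose_def)
  have qinv: "invertible q" using pos unfolding q_def by (rule pos_def_invertible)
  have Gn: "G *v n = t *\<^sub>R axis None 1"
    using normal_direction(1)[OF orth] by (simp add: t_def)
  have tn: "t * n $ None = - 1"
    using norm by (simp add: bil_def Gn inner_axis)
  have Gn_sum: "G $ i $ None * n $ None + (\<Sum>c\<in>UNIV. G $ i $ Some c * n $ Some c)
      = (if i = None then t else 0)" for i
  proof -
    have "(G *v n) $ i = (t *\<^sub>R axis None 1) $ i" by (simp only: Gn)
    then show ?thesis by (simp add: matrix_vector_mult_def sum_UNIV_option axis_def)
  qed
  define X :: "real^('d option)^('d option)" where
    "X = (\<chi> i j. (case (i, j) of (Some a, Some b) \<Rightarrow> matrix_inv q $ a $ b | _ \<Rightarrow> 0) - n $ i * n $ j)"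
  \<comment> \<open>The normal is proportional to (1, -shift), where the shift
    \<open>G $ None $ Some a\<close> is raised with q^{-1}. This comes from solving the tangential
    rows of G n = t e_None for the spatial part of n.\<close>
  have n_spatial: "n $ Some b = - n $ None * (\<Sum>a\<in>UNIV. G $ None $ Some a * matrix_inv q $ a $ b)" for b
  proof -
    have "(\<Sum>a\<in>UNIV. matrix_inv q $ b $ a *
        (G $ Some a $ None * n $ None + (\<Sum>c\<in>UNIV. q $ a $ c * n $ Some c))) = 0"
      using Gn_sum[of "Some _"] by (simp add: q)
    moreover have "(\<Sum>a\<in>UNIV. matrix_inv q $ b $ a * (\<Sum>c\<in>UNIV. q $ a $ c * n $ Some c)) = n $ Some b"
    proof -
      have "(\<Sum>a\<in>UNIV. matrix_inv q $ b $ a * (\<Sum>c\<in>UNIV. q $ a $ c * n $ Some c))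
          = (\<Sum>c\<in>UNIV. (\<Sum>a\<in>UNIV. matrix_inv q $ b $ a * q $ a $ c) * n $ Some c)"
        unfolding sum_distrib_left sum_distrib_right by (subst sum.swap) (simp add: mult.assoc)
      then show ?thesis
        by (simp add: matrix_inv_left_sum[OF qinv] if_distrib[where f="\<lambda>z. z * _"] cong: if_cong)
    qed
    ultimately have "n $ Some b = - (\<Sum>a\<in>UNIV. matrix_inv q $ b $ a * (G $ Some a $ None * n $ None))"
      by (simp add: distrib_left sum.distrib)
    then show ?thesis
      by (simp add: sum_distrib_left sum_negf mult_ac symmetric_entry[OF sym, of "Some _" None]
          symmetric_entry[OF transpose_matrix_inv[OF qsym qinv], of b])
  qed
  have "(G ** X) $ i $ j = (mat 1 :: real^('d option)^('d option)) $ i $ j" for i j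
  proof -
    have "(G ** X) $ i $ j
        = (\<Sum>a\<in>UNIV. G $ i $ Some a * (case j of Some b \<Rightarrow> matrix_inv q $ a $ b | None \<Rightarrow> 0))
          - (if i = None then t else 0) * n $ j"
      unfolding Gn_sum[symmetric]
      by (simp add: matrix_matrix_mult_def X_def sum_UNIV_option algebra_simps sum_subtractf
          sum_distrib_left split: option.split)
    also have "\<dots> = (mat 1 :: real^('d option)^('d option)) $ i $ j"
    proof (cases i)
      case None
      show ?thesis
      proof (cases j)
        case None
        with \<open>i = None\<close> tn show ?thesis by (simp add: mat_def)
      next
        case (Some b)
        have "t * n $ Some b = (\<Sum>a\<in>UNIV. G $ None $ Some a * matrix_inv q $ a $ b)"
          using tn by (simp add: n_spatial mult.assoc[symmetric])
        with None Some show ?thesis by (simp add: mat_def)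
      qed
    next
      case (Some a)
      then show ?thesis
        using matrix_inv_right_sum[OF qinv, of a]
        by (cases j) (simp_all add: mat_def q)
    qed
    finally show ?thesis .
  qed
  then have "G ** X = mat 1" by (simp add: vec_eq_iff)
  from matrix_inv_unique[OF this] show ?thesis
    unfolding q_def[symmetric] by (simp add: X_def)
qed

end

lemma lorentzian_invertible:
  fixes G :: "real^('a::finite option)^('a option)"
  assumes "lorentzian G"
  shows "invertible G"
proof -
  obtain E :: "real^('a option)^('a option)" where E: "transpose E ** G ** E = minkowski"
    using assms by (auto simp: lorentzian_def)
  have "(minkowski ** minkowski) $ i $ j = (mat 1 :: real^('a option)^('a option)) $ i $ j" for i j
  proof -
    have "(minkowski ** minkowski) $ i $ j = (\<Sum>k\<in>UNIV. if k = i then (if i = j then 1 else 0) else 0)"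
      unfolding matrix_matrix_mult_def vec_lambda_beta by (rule sum.cong) (auto simp: minkowski_def)
    then show ?thesis by (simp add: mat_def)
  qed
  then have "minkowski ** minkowski = (mat 1 :: real^('a option)^('a option))"
    by (simp add: vec_eq_iff)
  then have "det (minkowski :: real^('a option)^('a option)) * det (minkowski :: real^('a option)^('a option)) = 1"
    unfolding det_mul[symmetric] by simp
  then have "det (transpose E ** G ** E) \<noteq> 0" unfolding E by auto
  then have "det G \<noteq> 0" by (simp add: det_mul)
  then show ?thesis using invertible_det_nz by blast
qed

section \<open>The Riemann tensor with lowered indices\<close>

text \<open>Christoffel symbols of the first kind, with the lowered index first. They are free of
  the inverse metric and therefore compatible with restriction to the slice.\<close>

definition christoffel_low :: "(real^'n \<Rightarrow> real^'n^'n) \<Rightarrow> real^'n \<Rightarrow> 'n::finite \<Rightarrow> 'n \<Rightarrow> 'n \<Rightarrow> real" where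
  "christoffel_low h x k i j = (1/2) * (partial UNIV i (\<lambda>y. h y $ j $ k) x
     + partial UNIV j (\<lambda>y. h y $ i $ k) x - partial UNIV k (\<lambda>y. h y $ i $ j) x)"

text \<open>The form of R_{plij} in which the inverse metric occurs only in the quadratic term;
  \<open>riemann_lower\<close> justifies it.\<close>

definition riemann_low :: "(real^'n \<Rightarrow> real^'n^'n) \<Rightarrow> real^'n \<Rightarrow> 'n::finite \<Rightarrow> 'n \<Rightarrow> 'n \<Rightarrow> 'n \<Rightarrow> real" where
  "riemann_low h x p l i j =
     partial UNIV i (\<lambda>y. christoffel_low h y p j l) x - partial UNIV j (\<lambda>y. christoffel_low h y p i l) x
     - (\<Sum>k\<in>UNIV. \<Sum>m\<in>UNIV. matrix_inv (h x) $ k $ m *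
         (christoffel_low h x k i p * christoffel_low h x m j l
          - christoffel_low h x k j p * christoffel_low h x m i l))"

lemma christoffel_raise:
  "christoffel h x k i j = (\<Sum>l\<in>UNIV. matrix_inv (h x) $ k $ l * christoffel_low h x l i j)"
  by (simp add: christoffel_def christoffel_low_def sum_distrib_left mult_ac)

section \<open>Differentiability of determinants and inverse matrices\<close>

lemma differentiable_prod:
  fixes f :: "'i \<Rightarrow> real^'n::finite \<Rightarrow> real"
  assumes "\<And>i. i \<in> I \<Longrightarrow> f i differentiable (at x)"
  shows "(\<lambda>y. \<Prod>i\<in>I. f i y) differentiable (at x)"
  using assms
  by (induction I rule: infinite_finite_induct) (auto intro!: differentiable_mult)

lemma differentiable_det:
  fixes A :: "real^'n::finite \<Rightarrow> real^'m::finite^'m"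
  assumes "\<And>i j. (\<lambda>y. A y $ i $ j) differentiable (at x)"
  shows "(\<lambda>y. det (A y)) differentiable (at x)"
  unfolding det_def
  by (intro differentiable_sum ballI differentiable_mult differentiable_const differentiable_prod assms
      finite_permutations finite)

text \<open>Expresses the inverse through determinants, from which its differentiability in the
  point can be read off.\<close>

lemma matrix_inv_entry_cramer:
  fixes A :: "real^'n::finite^'n"
  assumes "invertible A"
  shows "matrix_inv A $ k $ l = det (\<chi> i j. if j = k then axis l 1 $ i else A $ i $ j) / det A"
proof -
  have "A *v (matrix_inv A *v axis l 1) = axis l 1"
    by (simp add: matrix_vector_mul_assoc matrix_inv_right[OF assms])
  then have "matrix_inv A *v axis l 1 = (\<chi> k. det (\<chi> i j. if j = k then axis l 1 $ i else A $ i $ j) / det A)"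
    using assms by (subst (asm) cramer) (simp_all add: invertible_det_nz)
  then have "(matrix_inv A *v axis l 1) $ k = det (\<chi> i j. if j = k then axis l 1 $ i else A $ i $ j) / det A"
    by simp
  then show ?thesis by (simp add: matrix_vector_mul_component inner_axis)
qed

lemma sum_swap_pairs:
  "(\<Sum>l\<in>A. \<Sum>j\<in>B. \<Sum>k\<in>C. \<Sum>p\<in>D. f l j k p) = (\<Sum>k\<in>C. \<Sum>p\<in>D. \<Sum>l\<in>A. \<Sum>j\<in>B. f l j k p)"
proof -
  have "(\<Sum>l\<in>A. \<Sum>j\<in>B. \<Sum>k\<in>C. \<Sum>p\<in>D. f l j k p) = (\<Sum>l\<in>A. \<Sum>k\<in>C. \<Sum>j\<in>B. \<Sum>p\<in>D. f l j k p)"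
    by (rule sum.cong[OF refl], rule sum.swap)
  also have "\<dots> = (\<Sum>k\<in>C. \<Sum>l\<in>A. \<Sum>j\<in>B. \<Sum>p\<in>D. f l j k p)"
    by (rule sum.swap)
  also have "\<dots> = (\<Sum>k\<in>C. \<Sum>l\<in>A. \<Sum>p\<in>D. \<Sum>j\<in>B. f l j k p)"
    by (rule sum.cong[OF refl], rule sum.cong[OF refl], rule sum.swap)
  also have "\<dots> = (\<Sum>k\<in>C. \<Sum>p\<in>D. \<Sum>l\<in>A. \<Sum>j\<in>B. f l j k p)"
    by (rule sum.cong[OF refl], rule sum.swap)
  finally show ?thesis .
qed

text \<open>No signature is assumed, so that the same calculus applies to the spacetime metric and
  to the induced metric.\<close>

locale metric_field =
  fixes U :: "(real^'n::finite) set" and h :: "real^'n \<Rightarrow> real^'n^'n"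
  assumes open_U: "open U"
    and smooth: "\<And>i j. smooth_on U (\<lambda>x. h x $ i $ j)"
    and sym: "\<And>x. x \<in> U \<Longrightarrow> transpose (h x) = h x"
    and inv: "\<And>x. x \<in> U \<Longrightarrow> invertible (h x)"
begin

lemma entry_sym: "x \<in> U \<Longrightarrow> h x $ i $ j = h x $ j $ i"
  using sym symmetric_entry by blast

lemma inverse_sym: "x \<in> U \<Longrightarrow> matrix_inv (h x) $ i $ j = matrix_inv (h x) $ j $ i"
  using transpose_matrix_inv[OF sym inv] symmetric_entry by blast

lemma partial_entry_sym:
  "x \<in> U \<Longrightarrow> partial UNIV k (\<lambda>y. h y $ i $ j) x = partial UNIV k (\<lambda>y. h y $ j $ i) x"
  by (rule partial_cong_open[OF open_U]) (assumption, rule entry_sym)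

lemma entry_differentiable: "x \<in> U \<Longrightarrow> (\<lambda>y. h y $ i $ j) differentiable (at x)"
  using smooth_on_differentiable[OF smooth] .

lemma partial_entry_differentiable:
  "x \<in> U \<Longrightarrow> partial UNIV k (\<lambda>y. h y $ i $ j) differentiable (at x)"
  using smooth_on_differentiable[OF smooth_on_partial[OF smooth]] .

lemma christoffel_low_differentiable:
  "x \<in> U \<Longrightarrow> (\<lambda>y. christoffel_low h y k i j) differentiable (at x)"
  unfolding christoffel_low_def
  by (intro differentiable_mult differentiable_const differentiable_add differentiable_diff
      partial_entry_differentiable)

lemma matrix_inv_differentiable:
  assumes "x \<in> U"
  shows "(\<lambda>y. matrix_inv (h y) $ k $ l) differentiable (at x)"
proof -
  have d: "(\<lambda>y. det (\<chi> i j. if j = k then axis l 1 $ i else h y $ i $ j) / det (h y)) differentiable (at x)"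
  proof (rule differentiable_divide)
    show "(\<lambda>y. det (\<chi> i j. if j = k then axis l 1 $ i else h y $ i $ j)) differentiable (at x)"
    proof (rule differentiable_det)
      fix i j
      show "(\<lambda>y. (\<chi> i j. if j = k then axis l 1 $ i else h y $ i $ j) $ i $ j) differentiable (at x)"
        using entry_differentiable[OF assms] by (cases "j = k") simp_all
    qed
    show "(\<lambda>y. det (h y)) differentiable (at x)"
      by (rule differentiable_det, rule entry_differentiable[OF assms])
    show "det (h x) \<noteq> 0" using inv[OF assms] by (simp add: invertible_det_nz)
  qed
  then obtain f' where f': "((\<lambda>y. det (\<chi> i j. if j = k then axis l 1 $ i else h y $ i $ j) / det (h y))
      has_derivative f') (at x)"
    unfolding differentiable_def by blast
  have "((\<lambda>y. matrix_inv (h y) $ k $ l) has_derivative f') (at x)"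
    by (rule has_derivative_transform_within_open[OF f' open_U assms])
       (simp add: matrix_inv_entry_cramer[OF inv])
  then show ?thesis unfolding differentiable_def by blast
qed

lemma christoffel_differentiable:
  "x \<in> U \<Longrightarrow> (\<lambda>y. christoffel h y k i j) differentiable (at x)"
  unfolding christoffel_raise
  by (intro differentiable_sum ballI differentiable_mult matrix_inv_differentiable
      christoffel_low_differentiable finite)

lemma lower_raise:
  assumes "x \<in> U"
  shows "(\<Sum>k\<in>UNIV. h x $ p $ k * (\<Sum>l\<in>UNIV. matrix_inv (h x) $ k $ l * f l)) = f p"
    and "(\<Sum>k\<in>UNIV. matrix_inv (h x) $ p $ k * (\<Sum>l\<in>UNIV. h x $ k $ l * f l)) = f p"
proof -
  have *: "(\<Sum>k\<in>UNIV. A $ p $ k * (\<Sum>l\<in>UNIV. B $ k $ l * f l)) = f p"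
    if "\<And>l. (\<Sum>k\<in>UNIV. A $ p $ k * B $ k $ l) = (if p = l then 1 else 0)" for A B :: "real^'n^'n"
  proof -
    have "(\<Sum>k\<in>UNIV. A $ p $ k * (\<Sum>l\<in>UNIV. B $ k $ l * f l))
        = (\<Sum>l\<in>UNIV. (\<Sum>k\<in>UNIV. A $ p $ k * B $ k $ l) * f l)"
      unfolding sum_distrib_left sum_distrib_right by (subst sum.swap) (simp add: mult.assoc)
    then show ?thesis by (simp add: that if_distrib[where f="\<lambda>z. z * _"] cong: if_cong)
  qed
  show "(\<Sum>k\<in>UNIV. h x $ p $ k * (\<Sum>l\<in>UNIV. matrix_inv (h x) $ k $ l * f l)) = f p"
    "(\<Sum>k\<in>UNIV. matrix_inv (h x) $ p $ k * (\<Sum>l\<in>UNIV. h x $ k $ l * f l)) = f p"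
    by (rule *, rule matrix_inv_right_sum[OF inv[OF assms]])
       (rule *, rule matrix_inv_left_sum[OF inv[OF assms]])
qed

lemma christoffel_lower:
  "x \<in> U \<Longrightarrow> (\<Sum>k\<in>UNIV. h x $ p $ k * christoffel h x k i j) = christoffel_low h x p i j"
  unfolding christoffel_raise by (rule lower_raise)

text \<open>Metric compatibility of the Levi-Civita connection in terms of first-kind
  symbols.\<close>

lemma partial_metric:
  "x \<in> U \<Longrightarrow> partial UNIV i (\<lambda>y. h y $ p $ k) x = christoffel_low h x p i k + christoffel_low h x k i p"
  by (simp add: christoffel_low_def partial_entry_sym[of x _ k p] partial_entry_sym[of x _ k i]
      partial_entry_sym[of x _ p i] add_divide_distrib diff_divide_distrib)

lemma partial_christoffel_lower:
  assumes "x \<in> U"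
  shows "(\<Sum>k\<in>UNIV. h x $ p $ k * partial UNIV i (\<lambda>y. christoffel h y k j l) x)
    = partial UNIV i (\<lambda>y. christoffel_low h y p j l) x
      - (\<Sum>k\<in>UNIV. (christoffel_low h x p i k + christoffel_low h x k i p) * christoffel h x k j l)"
proof -
  note diff = entry_differentiable[OF assms] christoffel_differentiable[OF assms]
  have "partial UNIV i (\<lambda>y. christoffel_low h y p j l) x
      = partial UNIV i (\<lambda>y. \<Sum>k\<in>UNIV. h y $ p $ k * christoffel h y k j l) x"
    by (rule partial_cong_open[OF open_U assms]) (simp add: christoffel_lower)
  also have "\<dots> = (\<Sum>k\<in>UNIV. h x $ p $ k * partial UNIV i (\<lambda>y. christoffel h y k j l) x
      + partial UNIV i (\<lambda>y. h y $ p $ k) x * christoffel h x k j l)"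
    by (subst partial_sum) (auto intro!: differentiable_mult diff sum.cong partial_mult)
  finally show ?thesis by (simp add: partial_metric[OF assms] sum.distrib)
qed

text \<open>After lowering, the terms quadratic in the Christoffel symbols that come from the
  derivative of the metric cancel half of those in the definition.\<close>

lemma riemann_lower:
  assumes "x \<in> U"
  shows "(\<Sum>k\<in>UNIV. h x $ p $ k * riemann h x k l i j) = riemann_low h x p l i j"
proof -
  have quad: "(\<Sum>k\<in>UNIV. h x $ p $ k * (\<Sum>m\<in>UNIV. christoffel h x k i m * christoffel h x m j l))
      = (\<Sum>m\<in>UNIV. christoffel_low h x p i m * christoffel h x m j l)" for i j
  proof -
    have "(\<Sum>k\<in>UNIV. h x $ p $ k * (\<Sum>m\<in>UNIV. christoffel h x k i m * christoffel h x m j l))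
      = (\<Sum>m\<in>UNIV. (\<Sum>k\<in>UNIV. h x $ p $ k * christoffel h x k i m) * christoffel h x m j l)"
      unfolding sum_distrib_left sum_distrib_right by (subst sum.swap) (simp add: mult.assoc)
    then show ?thesis by (simp add: christoffel_lower[OF assms])
  qed
  have raise: "(\<Sum>k\<in>UNIV. christoffel_low h x k i p * christoffel h x k j l)
     = (\<Sum>k\<in>UNIV. \<Sum>m\<in>UNIV. matrix_inv (h x) $ k $ m *
         (christoffel_low h x k i p * christoffel_low h x m j l))" for i j
    by (simp add: christoffel_raise sum_distrib_left mult_ac)
  have "(\<Sum>k\<in>UNIV. h x $ p $ k * riemann h x k l i j)
     = (\<Sum>k\<in>UNIV. h x $ p $ k * partial UNIV i (\<lambda>y. christoffel h y k j l) x)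
      - (\<Sum>k\<in>UNIV. h x $ p $ k * partial UNIV j (\<lambda>y. christoffel h y k i l) x)
      + (\<Sum>k\<in>UNIV. h x $ p $ k * (\<Sum>m\<in>UNIV. christoffel h x k i m * christoffel h x m j l))
      - (\<Sum>k\<in>UNIV. h x $ p $ k * (\<Sum>m\<in>UNIV. christoffel h x k j m * christoffel h x m i l))"
    by (simp add: riemann_def algebra_simps sum.distrib sum_subtractf)
  also have "\<dots> = partial UNIV i (\<lambda>y. christoffel_low h y p j l) x
      - partial UNIV j (\<lambda>y. christoffel_low h y p i l) x
      - (\<Sum>k\<in>UNIV. christoffel_low h x k i p * christoffel h x k j l)
      + (\<Sum>k\<in>UNIV. christoffel_low h x k j p * christoffel h x k i l)"
    unfolding quad partial_christoffel_lower[OF assms]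
    by (simp add: algebra_simps sum.distrib)
  also have "\<dots> = riemann_low h x p l i j"
    unfolding raise riemann_low_def by (simp add: right_diff_distrib sum_subtractf)
  finally show ?thesis .
qed

lemma riemann_raise:
  assumes "x \<in> U"
  shows "riemann h x k l i j = (\<Sum>p\<in>UNIV. matrix_inv (h x) $ k $ p * riemann_low h x p l i j)"
  unfolding riemann_lower[OF assms, symmetric] by (simp add: lower_raise[OF assms])

lemma ricci_low:
  "x \<in> U \<Longrightarrow> ricci h x $ l $ j
    = (\<Sum>k\<in>UNIV. \<Sum>p\<in>UNIV. matrix_inv (h x) $ k $ p * riemann_low h x p l k j)"
  by (simp add: ricci_def riemann_raise)

lemma riemann_low_antisym: "riemann_low h x p l i j = - riemann_low h x p l j i"
proof -
  have "(\<Sum>k\<in>UNIV. \<Sum>m\<in>UNIV. matrix_inv (h x) $ k $ m *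
         (christoffel_low h x k i p * christoffel_low h x m j l
          - christoffel_low h x k j p * christoffel_low h x m i l))
    = - (\<Sum>k\<in>UNIV. \<Sum>m\<in>UNIV. matrix_inv (h x) $ k $ m *
         (christoffel_low h x k j p * christoffel_low h x m i l
          - christoffel_low h x k i p * christoffel_low h x m j l))"
    unfolding sum_negf[symmetric] by (simp add: algebra_simps)
  then show ?thesis by (simp add: riemann_low_def)
qed

text \<open>Symmetrise in p and l. By \<open>partial_metric\<close> the derivative terms become
  second derivatives of the metric entry (p, l), which commute, and the quadratic terms cancel by
  the symmetry of the inverse metric.\<close>

lemma riemann_low_antisym_first:
  assumes "x \<in> U"
  shows "riemann_low h x p l i j = - riemann_low h x l p i j"
proof -
  define Q where "Q i p j l = (\<Sum>k\<in>UNIV. \<Sum>m\<in>UNIV. matrix_inv (h x) $ k $ m *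
         (christoffel_low h x k i p * christoffel_low h x m j l))" for i p j l
  have Qsym: "Q i p j l = Q j l i p" for i p j l
    unfolding Q_def by (subst sum.swap) (simp add: inverse_sym[OF assms] mult_ac)
  have R: "riemann_low h x p l i j = partial UNIV i (\<lambda>y. christoffel_low h y p j l) x
      - partial UNIV j (\<lambda>y. christoffel_low h y p i l) x - (Q i p j l - Q j p i l)" for p l
    unfolding riemann_low_def Q_def by (simp add: right_diff_distrib sum_subtractf)
  have D: "partial UNIV i (\<lambda>y. christoffel_low h y p j l) x + partial UNIV i (\<lambda>y. christoffel_low h y l j p) x
      = partial UNIV i (partial UNIV j (\<lambda>y. h y $ p $ l)) x" for i j
    unfolding partial_add[OF christoffel_low_differentiable[OF assms] christoffel_low_differentiable[OF assms], symmetric]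
    by (rule partial_cong_open[OF open_U assms]) (simp add: partial_metric)
  show ?thesis
    using R[of p l] R[of l p] D[of i j] D[of j i] Qsym[of i p j l] Qsym[of j p i l]
      partial_commute[OF smooth open_U assms, of i j p l] by linarith
qed

lemma riemann_low_pair_swap:
  "x \<in> U \<Longrightarrow> riemann_low h x p l k j = riemann_low h x l p j k"
  using riemann_low_antisym_first[of x p l k j] riemann_low_antisym[of x l p k j] by simp

text \<open>Expand bilinearly with H = g^{-1} + n n. Two inverse metrics give the scalar curvature,
  each mixed term gives Ric(n, n), and four copies of n give zero by antisymmetry. For a unit
  timelike n the right-hand side is 2 G(n, n), while the left-hand side sees only tangential
  components once H is the padded q^{-1}.\<close>

lemma contract_with_split_inverse:
  assumes x: "x \<in> U"
    and H: "\<And>i j. matrix_inv (h x) $ i $ j = H i j - n $ i * n $ j"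
  shows "(\<Sum>l\<in>UNIV. \<Sum>j\<in>UNIV. H l j * (\<Sum>k\<in>UNIV. \<Sum>p\<in>UNIV. H k p * riemann_low h x p l k j))
    = scalar_curv h x + 2 * bil (ricci h x) n n"
proof -
  define T where "T A B = (\<Sum>l\<in>UNIV. \<Sum>j\<in>UNIV. \<Sum>k\<in>UNIV. \<Sum>p\<in>UNIV. A l j * (B k p * riemann_low h x p l k j))"
    for A B :: "'n \<Rightarrow> 'n \<Rightarrow> real"
  define I where "I i j = matrix_inv (h x) $ i $ j" for i j
  define N where "N i j = n $ i * n $ j" for i j
  have HI: "H i j = I i j + N i j" for i j by (simp add: I_def N_def H)
  have "T H H = T I I + T N I + T I N + T N N"
    by (simp add: T_def HI algebra_simps sum.distrib)
  moreover have "T I I = scalar_curv h x"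
    by (simp add: T_def I_def scalar_curv_def ricci_low[OF x] sum_distrib_left)
  moreover have "T N I = bil (ricci h x) n n"
    by (simp add: T_def I_def N_def bil_sum ricci_low[OF x] sum_distrib_left mult_ac)
  \<comment> \<open>Renaming the summation indices exchanges the two index pairs;
    \<open>riemann_low_pair_swap\<close> compensates for the exchange inside both pairs.\<close>
  moreover have "T I N = T N I"
  proof -
    have "T I N = (\<Sum>k\<in>UNIV. \<Sum>p\<in>UNIV. \<Sum>l\<in>UNIV. \<Sum>j\<in>UNIV. I l j * (N k p * riemann_low h x p l k j))"
      unfolding T_def by (rule sum_swap_pairs)
    also have "\<dots> = (\<Sum>p\<in>UNIV. \<Sum>k\<in>UNIV. \<Sum>j\<in>UNIV. \<Sum>l\<in>UNIV. I l j * (N k p * riemann_low h x p l k j))"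
      by (rule trans[OF sum.swap], rule sum.cong[OF refl], rule sum.cong[OF refl], rule sum.swap)
    also have "\<dots> = (\<Sum>p\<in>UNIV. \<Sum>k\<in>UNIV. \<Sum>j\<in>UNIV. \<Sum>l\<in>UNIV. N p k * (I j l * riemann_low h x l p j k))"
    proof (intro sum.cong refl)
      fix p k j l
      show "I l j * (N k p * riemann_low h x p l k j) = N p k * (I j l * riemann_low h x l p j k)"
        using riemann_low_pair_swap[OF x, of p l k j] inverse_sym[OF x, of l j]
        by (simp add: I_def N_def)
    qed
    finally show ?thesis by (simp add: T_def)
  qed
  moreover have "T N N = 0"
  proof -
    have "T N N = (\<Sum>l\<in>UNIV. \<Sum>k\<in>UNIV. \<Sum>j\<in>UNIV. \<Sum>p\<in>UNIV. N l j * (N k p * riemann_low h x p l k j))"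
      unfolding T_def by (rule sum.cong[OF refl], rule sum.swap)
    also have "\<dots> = (\<Sum>l\<in>UNIV. \<Sum>k\<in>UNIV. \<Sum>j\<in>UNIV. \<Sum>p\<in>UNIV. - (N l k * (N j p * riemann_low h x p l j k)))"
    proof (intro sum.cong refl)
      fix l k j p
      show "N l j * (N k p * riemann_low h x p l k j) = - (N l k * (N j p * riemann_low h x p l j k))"
        using riemann_low_antisym[of x p l k j] by (simp add: N_def)
    qed
    also have "\<dots> = - T N N" by (simp add: T_def sum_negf)
    finally show ?thesis by simp
  qed
  ultimately have "T H H = scalar_curv h x + 2 * bil (ricci h x) n n" by simp
  then show ?thesis by (simp add: T_def sum_distrib_left)
qed

end

section \<open>The Gauss equation\<close>

lemma continuous_emb: "continuous_on S emb"
  by (rule linear_continuous_on[OF linear_emb[unfolded linear_conv_bounded_linear]])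

lemma open_vimage_emb: "open U \<Longrightarrow> open (emb -` U)"
  by (rule open_vimage[OF _ continuous_emb])

lemma smooth_on_subset:
  assumes "smooth_on S f" "T \<subseteq> S"
  shows "smooth_on T f"
proof -
  have "Ck_on k S f \<Longrightarrow> Ck_on k T f" for k
    using assms(2) by (induction k arbitrary: f) (auto intro: continuous_on_subset)
  then show ?thesis using assms(1) unfolding smooth_on_def by blast
qed

lemma smooth_on_compose_emb:
  assumes "smooth_on U f" "open U"
  shows "smooth_on (emb -` U) (\<lambda>y. f (emb y))"
proof -
  have op: "open (emb -` U)"
    using assms(2) by (rule open_vimage_emb)
  have "Ck_on k (emb -` U) (\<lambda>y. f (emb y))" if "smooth_on U f" for k f
    using that
  proof (induction k arbitrary: f)
    case 0
    have "continuous_on (emb -` U) (f \<circ> emb)"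
      by (rule continuous_on_compose)
         (auto intro: continuous_emb continuous_on_subset[OF smooth_on_continuous[OF 0]])
    then show ?case by (simp add: comp_def)
  next
    case (Suc k)
    \<comment> \<open>The partial derivative of the restriction agrees with the restricted partial
      derivative only on the open preimage, so \<open>Ck_on\<close> must be shown insensitive to
      values elsewhere.\<close>
    have cong: "Ck_on k S f = Ck_on k S g" if "open S" "\<And>y. y \<in> S \<Longrightarrow> f y = g y"
      for k S and f g :: "real^'a \<Rightarrow> real"
      using that
    proof (induction k arbitrary: f g)
      case 0
      then show ?case using continuous_on_cong[of S S f g] by simp
    next
      case (Suc k)
      have "f differentiable (at x) \<longleftrightarrow> g differentiable (at x)" if "x \<in> S" for x
        using has_derivative_transform_within_open[of f _ x UNIV S g]
          has_derivative_transform_within_open[of g _ x UNIV S f] Suc.prems that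
        unfolding differentiable_def by metis
      moreover have "Ck_on k S (partial UNIV i f) \<longleftrightarrow> Ck_on k S (partial UNIV i g)" for i
        by (rule Suc.IH[OF Suc.prems(1)], rule partial_cong_open[OF Suc.prems(1)])
           (use Suc.prems in auto)
      ultimately show ?case by auto
    qed
    have "Ck_on k (emb -` U) (partial UNIV a (\<lambda>y. f (emb y)))" for a
    proof -
      have "Ck_on k (emb -` U) (\<lambda>y. partial UNIV (Some a) f (emb y))"
        by (rule Suc.IH[OF smooth_on_partial[OF Suc.prems]])
      then show ?thesis
        by (subst cong[OF op])
           (auto intro: partial_compose_linear linear_emb emb_axis smooth_on_differentiable[OF Suc.prems])
    qed
    moreover have "(\<lambda>y. f (emb y)) differentiable (at x)" if "x \<in> emb -` U" for x
      using that by (intro differentiable_compose_linear[OF linear_emb smooth_on_differentiable[OF Suc.prems]]) simp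
    ultimately show ?case by simp
  qed
  then show ?thesis using assms(1) by (simp add: smooth_on_def)
qed

definition induced :: "(real^('d::finite option) \<Rightarrow> real^('d option)^('d option)) \<Rightarrow> real^'d \<Rightarrow> real^'d^'d" where
  "induced g y = spatial_block (g (emb y))"

lemma induced_nth: "induced g y $ a $ b = g (emb y) $ Some a $ Some b"
  by (simp add: induced_def spatial_block_def)

text \<open>\<open>Kext\<close> with the normal as a parameter. The Gauss equation is quadratic in
  it, so the time direction of n is left open here.\<close>

definition second_form ::
  "(real^('d::finite option) \<Rightarrow> real^('d option)^('d option)) \<Rightarrow> real^('d option) \<Rightarrow> real^('d option)
     \<Rightarrow> real^'d^'d" where
  "second_form g n x = (\<chi> a b. - (\<Sum>\<mu>\<in>UNIV. (g x *v n) $ \<mu> * christoffel g x \<mu> (Some a) (Some b)))"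

locale spacelike_hypersurface = metric_field U g
  for U :: "(real^('d::finite option)) set" and g +
  fixes o_vec :: "real^('d option)" and y :: "real^'d"
  assumes mem: "emb y \<in> U"
    and timelike: "bil (g (emb y)) o_vec o_vec < 0"
    and pos: "\<And>v. v \<noteq> 0 \<Longrightarrow> bil (induced g y) v v > 0"
begin

text \<open>Positive definiteness is known at y only, whereas \<open>metric_field\<close> wants an
  invertible metric on an open set. Nondegeneracy is an open condition and holds at y.\<close>

definition V where "V = {z \<in> emb -` U. det (induced g z) \<noteq> 0}"

lemma induced_smooth: "smooth_on (emb -` U) (\<lambda>z. induced g z $ a $ b)"
  unfolding induced_nth by (rule smooth_on_compose_emb[OF smooth open_U])

lemma open_V: "open V"
proof -
  have "continuous_on (emb -` U) (\<lambda>z. det (induced g z))"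
    unfolding det_def
    by (intro continuous_on_sum continuous_on_mult continuous_on_const continuous_on_prod smooth_on_continuous[OF induced_smooth])
  then have "open ((emb -` U) \<inter> (\<lambda>z. det (induced g z)) -` (- {0}))"
    by (rule continuous_open_preimage[OF _ open_vimage_emb[OF open_U]]) (simp add: open_Compl)
  moreover have "(emb -` U) \<inter> (\<lambda>z. det (induced g z)) -` (- {0}) = V"
    by (auto simp: V_def)
  ultimately show ?thesis by simp
qed

sublocale slice: metric_field V "induced g"
proof
  show "open V" by (rule open_V)
  show "smooth_on V (\<lambda>x. induced g x $ i $ j)" for i j
    by (rule smooth_on_subset[OF induced_smooth]) (auto simp: V_def)
  show "transpose (induced g x) = induced g x" if "x \<in> V" for x
    using that entry_sym[of "emb x"] by (simp add: V_def transpose_def vec_eq_iff induced_nth)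
  show "invertible (induced g x)" if "x \<in> V" for x
    using that by (simp add: V_def invertible_det_nz)
qed

lemma y_in_V: "y \<in> V"
  using mem pos_def_invertible[of "induced g y"] pos by (simp add: V_def invertible_det_nz)

sublocale spacelike_split "g (emb y)" o_vec
  by unfold_locales (use sym inv mem timelike pos in \<open>auto simp: induced_def\<close>)

text \<open>Only tangential derivatives of tangential components occur, and these commute with
  restriction.\<close>

lemma christoffel_low_induced:
  assumes "emb z \<in> U"
  shows "christoffel_low (induced g) z a b c = christoffel_low g (emb z) (Some a) (Some b) (Some c)"
  unfolding christoffel_low_def induced_nth
  by (simp add: partial_compose_linear[OF linear_emb entry_differentiable[OF assms] emb_axis])

lemma partial_christoffel_low_induced:
  "partial UNIV d (\<lambda>z. christoffel_low (induced g) z a b c) y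
    = partial UNIV (Some d) (\<lambda>x. christoffel_low g x (Some a) (Some b) (Some c)) (emb y)"
proof -
  have "partial UNIV d (\<lambda>z. christoffel_low (induced g) z a b c) y
      = partial UNIV d (\<lambda>z. christoffel_low g (emb z) (Some a) (Some b) (Some c)) y"
    by (rule partial_cong_open[OF open_V y_in_V]) (simp add: christoffel_low_induced V_def)
  also have "\<dots> = partial UNIV (Some d) (\<lambda>x. christoffel_low g x (Some a) (Some b) (Some c)) (emb y)"
    by (rule partial_compose_linear[OF linear_emb christoffel_low_differentiable[OF mem] emb_axis])
  finally show ?thesis .
qed

context
  fixes n :: "real^('d option)"
  assumes norm: "bil (g (emb y)) n n = - 1"
    and orth: "\<And>a. bil (g (emb y)) n (axis (Some a) 1) = 0"
begin

abbreviation II where "II \<equiv> second_form g n (emb y)"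

lemma second_form_low: "II $ a $ b = - (\<Sum>k\<in>UNIV. n $ k * christoffel_low g (emb y) k (Some a) (Some b))"
proof -
  have "(\<Sum>\<mu>\<in>UNIV. (g (emb y) *v n) $ \<mu> * christoffel g (emb y) \<mu> i j)
      = (\<Sum>k\<in>UNIV. n $ k * (\<Sum>\<mu>\<in>UNIV. g (emb y) $ k $ \<mu> * christoffel g (emb y) \<mu> i j))" for i j
    unfolding matrix_vector_mult_def vec_lambda_beta sum_distrib_left sum_distrib_right
    by (subst sum.swap) (simp add: entry_sym[OF mem] mult_ac)
  then show ?thesis by (simp add: second_form_def christoffel_lower[OF mem])
qed

text \<open>The derivative terms of \<open>riemann_low\<close> agree on both sides. In the quadratic
  term the padded q^{-1} reproduces the intrinsic part, and -n n contracts the first-kind symbols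
  with n, which yields products of the second fundamental form by
  \<open>second_form_low\<close>.\<close>

lemma Gauss_equation:
  "riemann_low g (emb y) (Some p) (Some l) (Some i) (Some j)
    = riemann_low (induced g) y p l i j + II $ i $ p * II $ j $ l - II $ j $ p * II $ i $ l"
proof -
  let ?C = "christoffel_low g (emb y)"
  define F where "F i p j l k m = ?C k (Some i) (Some p) * ?C m (Some j) (Some l)
      - ?C k (Some j) (Some p) * ?C m (Some i) (Some l)" for i p j l k m
  have split: "matrix_inv (g (emb y)) $ k $ m = (case (k, m) of
      (Some a, Some b) \<Rightarrow> matrix_inv (induced g y) $ a $ b | _ \<Rightarrow> 0) - n $ k * n $ m" for k m
    unfolding induced_def by (rule matrix_inv_split[OF norm orth])
  have "(\<Sum>k\<in>UNIV. \<Sum>m\<in>UNIV. matrix_inv (g (emb y)) $ k $ m * F i p j l k m)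
      = (\<Sum>a\<in>UNIV. \<Sum>b\<in>UNIV. matrix_inv (induced g y) $ a $ b * F i p j l (Some a) (Some b))
        - (\<Sum>k\<in>UNIV. \<Sum>m\<in>UNIV. n $ k * n $ m * F i p j l k m)"
    unfolding split left_diff_distrib sum_subtractf
    by (simp add: sum_UNIV_option)
  also have "(\<Sum>k\<in>UNIV. \<Sum>m\<in>UNIV. n $ k * n $ m * F i p j l k m) = II $ i $ p * II $ j $ l - II $ j $ p * II $ i $ l"
  proof -
    have prod: "(\<Sum>k\<in>UNIV. \<Sum>m\<in>UNIV. n $ k * n $ m * (A k * B m))
        = (\<Sum>k\<in>UNIV. n $ k * A k) * (\<Sum>m\<in>UNIV. n $ m * B m)" for A B
      by (simp add: sum_product mult_ac)
    show ?thesis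
      unfolding F_def right_diff_distrib sum_subtractf prod by (simp add: second_form_low)
  qed
  finally show ?thesis
    unfolding riemann_low_def partial_christoffel_low_induced
    by (simp add: F_def christoffel_low_induced[OF mem])
qed

theorem Gauss_normal_normal:
  "2 * bil (einstein g (emb y)) n n = scalar_curv (induced g) y
    + (\<Sum>a\<in>UNIV. \<Sum>b\<in>UNIV. matrix_inv (induced g y) $ a $ b * II $ a $ b)\<^sup>2
    - (\<Sum>b\<in>UNIV. \<Sum>d\<in>UNIV. \<Sum>c\<in>UNIV. \<Sum>a\<in>UNIV.
        matrix_inv (induced g y) $ b $ d * matrix_inv (induced g y) $ c $ a * II $ d $ a * II $ c $ b)"
proof -
  define Q where "Q a b = matrix_inv (induced g y) $ a $ b" for a b
  define H where "H k m = (case (k, m) of (Some a, Some b) \<Rightarrow> Q a b | _ \<Rightarrow> 0)" for k m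
  have H: "matrix_inv (g (emb y)) $ k $ m = H k m - n $ k * n $ m" for k m
    unfolding H_def Q_def induced_def by (rule matrix_inv_split[OF norm orth])
  have "scalar_curv g (emb y) + 2 * bil (ricci g (emb y)) n n
    = (\<Sum>l\<in>UNIV. \<Sum>j\<in>UNIV. H l j * (\<Sum>k\<in>UNIV. \<Sum>p\<in>UNIV. H k p * riemann_low g (emb y) p l k j))"
    by (rule contract_with_split_inverse[OF mem H, symmetric])
  also have "\<dots> = (\<Sum>b\<in>UNIV. \<Sum>d\<in>UNIV. Q b d * (\<Sum>c\<in>UNIV. \<Sum>a\<in>UNIV. Q c a *
      riemann_low g (emb y) (Some a) (Some b) (Some c) (Some d)))"
    by (simp add: sum_UNIV_option H_def)
  also have "\<dots> = (\<Sum>b\<in>UNIV. \<Sum>d\<in>UNIV. Q b d * (\<Sum>c\<in>UNIV. \<Sum>a\<in>UNIV. Q c a * riemann_low (induced g) y a b c d))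
     + (\<Sum>b\<in>UNIV. \<Sum>d\<in>UNIV. Q b d * (\<Sum>c\<in>UNIV. \<Sum>a\<in>UNIV. Q c a * (II $ c $ a * II $ d $ b)))
     - (\<Sum>b\<in>UNIV. \<Sum>d\<in>UNIV. Q b d * (\<Sum>c\<in>UNIV. \<Sum>a\<in>UNIV. Q c a * (II $ d $ a * II $ c $ b)))"
    unfolding Gauss_equation by (simp add: distrib_left right_diff_distrib sum.distrib sum_subtractf)
  also have "(\<Sum>b\<in>UNIV. \<Sum>d\<in>UNIV. Q b d * (\<Sum>c\<in>UNIV. \<Sum>a\<in>UNIV. Q c a * riemann_low (induced g) y a b c d))
      = scalar_curv (induced g) y"
    by (simp add: scalar_curv_def slice.ricci_low[OF y_in_V] Q_def)
  also have "(\<Sum>b\<in>UNIV. \<Sum>d\<in>UNIV. Q b d * (\<Sum>c\<in>UNIV. \<Sum>a\<in>UNIV. Q c a * (II $ c $ a * II $ d $ b)))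
      = (\<Sum>a\<in>UNIV. \<Sum>b\<in>UNIV. Q a b * II $ a $ b)\<^sup>2"
  proof -
    have Qs: "Q b d = Q d b" for b d using slice.inverse_sym[OF y_in_V] by (simp add: Q_def)
    have "(\<Sum>b\<in>UNIV. \<Sum>d\<in>UNIV. Q b d * (\<Sum>c\<in>UNIV. \<Sum>a\<in>UNIV. Q c a * (II $ c $ a * II $ d $ b)))
        = (\<Sum>b\<in>UNIV. \<Sum>d\<in>UNIV. (Q d b * II $ d $ b) * (\<Sum>c\<in>UNIV. \<Sum>a\<in>UNIV. Q c a * II $ c $ a))"
      by (simp add: sum_distrib_left mult_ac Qs)
    also have "\<dots> = (\<Sum>b\<in>UNIV. \<Sum>d\<in>UNIV. Q d b * II $ d $ b) * (\<Sum>c\<in>UNIV. \<Sum>a\<in>UNIV. Q c a * II $ c $ a)"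
      by (simp only: sum_distrib_right)
    also have "(\<Sum>b\<in>UNIV. \<Sum>d\<in>UNIV. Q d b * II $ d $ b) = (\<Sum>c\<in>UNIV. \<Sum>a\<in>UNIV. Q c a * II $ c $ a)"
      by (rule sum.swap)
    finally show ?thesis by (simp add: power2_eq_square)
  qed
  finally have main: "scalar_curv g (emb y) + 2 * bil (ricci g (emb y)) n n
    = scalar_curv (induced g) y + (\<Sum>a\<in>UNIV. \<Sum>b\<in>UNIV. Q a b * II $ a $ b)\<^sup>2
     - (\<Sum>b\<in>UNIV. \<Sum>d\<in>UNIV. Q b d * (\<Sum>c\<in>UNIV. \<Sum>a\<in>UNIV. Q c a * (II $ d $ a * II $ c $ b)))" .
  have "bil (einstein g (emb y)) n n = bil (ricci g (emb y)) n n
      - (1/2) * scalar_curv g (emb y) * bil (g (emb y)) n n"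
    by (simp add: bil_sum einstein_def right_diff_distrib left_diff_distrib sum_subtractf
        sum_distrib_left mult_ac)
  then have "2 * bil (einstein g (emb y)) n n = scalar_curv g (emb y) + 2 * bil (ricci g (emb y)) n n"
    by (simp add: norm)
  with main show ?thesis by (simp add: Q_def sum_distrib_left mult.assoc)
qed

end

end

section \<open>The bound on the potential of the lapse equation\<close>

lemma trace_mul4:
  fixes A B C E :: "real^'n::finite^'n"
  shows "trace (A ** (B ** (C ** E)))
    = (\<Sum>a\<in>UNIV. \<Sum>b\<in>UNIV. \<Sum>c\<in>UNIV. \<Sum>d\<in>UNIV. A $ a $ b * (B $ b $ c * (C $ c $ d * E $ d $ a)))"
  by (simp add: trace_def matrix_matrix_mult_def sum_distrib_left)

lemma trace_mul_entries:
  fixes A B :: "real^'n::finite^'n"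
  assumes "transpose B = B"
  shows "trace (A ** B) = (\<Sum>a\<in>UNIV. \<Sum>b\<in>UNIV. A $ a $ b * B $ a $ b)"
  by (simp add: trace_def matrix_matrix_mult_def symmetric_entry[OF assms, of _ "_ :: 'n"])

lemma matrix_diff_mult_distrib:
  fixes A B C :: "real^'n::finite^'n"
  shows "(A - B) ** C = A ** C - B ** C" and "C ** (A - B) = C ** A - C ** B"
  by (simp_all add: vec_eq_iff matrix_matrix_mult_def left_diff_distrib right_diff_distrib sum_subtractf)

lemma matrix_mult_scaleR:
  fixes A B :: "real^'n::finite^'n"
  shows "(c *\<^sub>R A) ** B = c *\<^sub>R (A ** B)" and "A ** (c *\<^sub>R B) = c *\<^sub>R (A ** B)"
  by (simp_all add: vec_eq_iff matrix_matrix_mult_def sum_distrib_left mult_ac)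

lemma trace_square_traceless:
  fixes m :: "real^'n::finite^'n"
  shows "trace ((m - c *\<^sub>R mat 1) ** (m - c *\<^sub>R mat 1))
    = trace (m ** m) - 2 * c * trace m + c\<^sup>2 * real CARD('n)"
proof -
  have "(m - c *\<^sub>R mat 1) ** (m - c *\<^sub>R mat 1) = m ** m - c *\<^sub>R m - c *\<^sub>R m + (c * c) *\<^sub>R mat 1"
    by (simp add: matrix_diff_mult_distrib matrix_mult_scaleR scaleR_diff_right)
  moreover have "trace (r *\<^sub>R A) = r * trace A" for r and A :: "real^'n^'n"
    by (simp add: trace_def sum_distrib_left)
  ultimately show ?thesis
    by (simp only: trace_add trace_sub trace_I) (simp add: power2_eq_square)
qed

section \<open>Geometry and canonical data at one point of the slice, in one slice chart\<close>

locale slice_point =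
  fixes M :: "('m::topological_space, 'd::finite) spacetime" and \<sigma> :: "'m set"
    and p :: 'm and c :: "('m, 'd option) chart"
  assumes spacetime: "spacetime_with_scalar M"
    and slice: "compact_spatial_slice M \<sigma>"
    and p_in: "p \<in> \<sigma>"
    and c_in: "c \<in> slice_charts_at M \<sigma> p"
begin

abbreviation y where "y \<equiv> spat c p"
abbreviation q where "q \<equiv> qmet M c y"
abbreviation n where "n \<equiv> unit_normal M c y"
abbreviation K where "K \<equiv> Kext M c y"

lemma in_atlas: "c \<in> atlas M" and p_in_chart: "p \<in> fst c"
  using c_in by (auto simp: slice_charts_at_def interior_slice_chart_def boundary_slice_chart_def)

lemma emb_y: "emb y = snd c p"
proof -
  have "snd c p $ None = 0"
    using c_in p_in by (auto simp: slice_charts_at_def interior_slice_chart_def boundary_slice_chart_def)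
  then show ?thesis by (simp add: vec_eq_iff emb_def spat_def split: option.split)
qed

lemma emb_y_in: "emb y \<in> codom c"
  using p_in_chart by (simp add: emb_y codom_def)

lemma chart: "is_chart c"
  using spacetime in_atlas by (simp add: spacetime_with_scalar_def maximal_atlas_def)

lemma param_emb_y: "param c (emb y) = p"
  using chart p_in_chart by (simp add: emb_y is_chart_def homeomorphism_def)

lemma phi_slice_y: "phi_slice M c y = phi M p"
  by (simp add: phi_slice_def param_emb_y)

lemma induced_qmet: "induced (gmet M c) = qmet M c"
  by (simp add: fun_eq_iff vec_eq_iff induced_nth qmet_def)

lemma q_pos: "v \<noteq> 0 \<Longrightarrow> bil q v v > 0"
  using slice p_in c_in by (simp add: compact_spatial_slice_def)

lemma lorentz: "lorentzian_metric M" and orientation: "time_orientation M"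
  using spacetime by (simp_all add: spacetime_with_scalar_def)

sublocale spacelike_hypersurface "codom c" "gmet M c" "orient M c (emb y)" y
proof
  show "open (codom c)" using chart by (simp add: is_chart_def)
  show "smooth_on (codom c) (\<lambda>x. gmet M c x $ i $ j)" for i j
    using lorentz in_atlas by (simp add: lorentzian_metric_def)
  have "lorentzian (gmet M c x)" if "x \<in> codom c" for x
    using lorentz in_atlas that by (simp add: lorentzian_metric_def)
  then show "transpose (gmet M c x) = gmet M c x" "invertible (gmet M c x)" if "x \<in> codom c" for x
    using that lorentzian_invertible lorentzian_def by blast+
  show "emb y \<in> codom c" by (rule emb_y_in)
  then show "bil (gmet M c (emb y)) (orient M c (emb y)) (orient M c (emb y)) < 0"
    using orientation in_atlas by (simp add: time_orientation_def)
  show "bil (induced (gmet M c) y) v v > 0" if "v \<noteq> 0" for v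
    using q_pos[OF that] by (simp add: induced_qmet)
qed

lemma normal:
  shows normal_norm: "bil (gmet M c (emb y)) n n = - 1"
    and normal_orth: "bil (gmet M c (emb y)) n (axis (Some a) 1) = 0"
    and normal_future: "bil (gmet M c (emb y)) (orient M c (emb y)) n < 0"
proof -
  have "bil (gmet M c (emb y)) n n = - 1 \<and> (\<forall>a. bil (gmet M c (emb y)) n (axis (Some a) 1) = 0) \<and>
      bil (gmet M c (emb y)) (orient M c (emb y)) n < 0"
    unfolding unit_normal_def Let_def by (rule theI'[OF ex1_unit_normal])
  then show "bil (gmet M c (emb y)) n n = - 1" "bil (gmet M c (emb y)) n (axis (Some a) 1) = 0"
    "bil (gmet M c (emb y)) (orient M c (emb y)) n < 0" by blast+
qed

lemma K_second_form: "K = second_form (gmet M c) n (emb y)"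
  by (simp add: Kext_def second_form_def)

lemma q_sym: "transpose q = q"
  using slice.sym[OF y_in_V] by (simp add: induced_qmet)

lemma q_inv: "invertible q"
  using q_pos by (rule pos_def_invertible)

lemma q_psd: "bil q v v \<ge> 0"
  using q_pos[of v] by (cases "v = 0") auto

lemma det_q_pos: "det q > 0"
  using q_sym q_pos by (rule pos_def_det_pos)

abbreviation Q where "Q \<equiv> matrix_inv q"

lemma Q_sym: "transpose Q = Q"
  by (rule transpose_matrix_inv[OF q_sym q_inv])

lemma K_sym: "transpose K = K"
proof -
  have "christoffel_low (gmet M c) (emb y) k i j = christoffel_low (gmet M c) (emb y) k j i" for k i j
    by (simp add: christoffel_low_def partial_entry_sym[OF mem, of k i j])
  then show ?thesis
    by (simp add: K_second_form second_form_low[OF normal_norm normal_orth] transpose_def vec_eq_iff)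
qed

text \<open>The tensor K^a_b. Its trace is K, and the trace of its square is K_{ab} K^{ab}, so the
  contractions become matrix algebra.\<close>

abbreviation mixed where "mixed \<equiv> Q ** K"

lemma Ktr_trace: "Ktr M c y = trace mixed"
  by (simp add: Ktr_def trace_mul_entries[OF K_sym])

lemma Kup_matrix: "Kup M c y = Q ** (K ** Q)"
  by (simp add: Kup_def Let_def vec_eq_iff matrix_matrix_mult_def sum_distrib_left
      symmetric_entry[OF Q_sym, of _ "_ :: 'd"] mult_ac)

lemma Kup_sym: "transpose (Kup M c y) = Kup M c y"
  by (simp add: Kup_matrix matrix_transpose_mul Q_sym K_sym matrix_mul_assoc)

lemma Kup_q: "Kup M c y ** q = mixed"
  by (simp add: Kup_matrix matrix_mul_assoc[symmetric] matrix_inv_left[OF q_inv])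

lemma q_Kup_contract: "(\<Sum>a\<in>UNIV. \<Sum>b\<in>UNIV. q $ a $ b * Kup M c y $ a $ b) = trace mixed"
  using trace_mul_entries[OF Kup_sym, of q] trace_mul_sym[of q "Kup M c y"] by (simp add: Kup_q)

lemma q_Q_contract: "(\<Sum>a\<in>UNIV. \<Sum>b\<in>UNIV. q $ a $ b * Q $ a $ b) = real CARD('d)"
  using trace_mul_entries[OF Q_sym, of q] by (simp add: matrix_inv_right[OF q_inv] trace_I)

lemma K_square_trace:
  "(\<Sum>b\<in>UNIV. \<Sum>d\<in>UNIV. \<Sum>c\<in>UNIV. \<Sum>a\<in>UNIV. Q $ b $ d * Q $ c $ a * K $ d $ a * K $ c $ b)
    = trace (mixed ** mixed)"
proof -
  have "trace (mixed ** mixed) = trace (Q ** (K ** (Q ** K)))"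
    by (simp add: matrix_mul_assoc)
  also have "\<dots> = (\<Sum>b\<in>UNIV. \<Sum>d\<in>UNIV. \<Sum>c\<in>UNIV. \<Sum>a\<in>UNIV. Q $ b $ d * (K $ d $ a * (Q $ a $ c * K $ c $ b)))"
    unfolding trace_mul4 by (rule sum.cong[OF refl], rule sum.cong[OF refl], rule sum.swap)
  finally show ?thesis
    by (simp add: symmetric_entry[OF Q_sym, of _ "_ :: 'd"] mult_ac)
qed

theorem Hamiltonian_identity:
  "2 * bil (einstein (gmet M c) (emb y)) n n
    = scalar_curv (qmet M c) y + (trace mixed)\<^sup>2 - trace (mixed ** mixed)"
  using Gauss_normal_normal[OF normal_norm normal_orth]
  unfolding induced_qmet K_second_form[symmetric] K_square_trace
  by (simp add: trace_mul_entries[OF K_sym])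

abbreviation shear where "shear \<equiv> Kup M c y - (trace mixed / real CARD('d)) *\<^sub>R Q"

text \<open>Lowering one index turns the shear into \<open>mixed\<close> minus its trace part, and
  the squared norm into the trace of a matrix square, to which \<open>trace_square_traceless\<close>
  applies with c = K / D.\<close>

lemma shear_square:
  "(\<Sum>a\<in>UNIV. \<Sum>b\<in>UNIV. \<Sum>d\<in>UNIV. \<Sum>e\<in>UNIV. q $ a $ d * q $ b $ e * shear $ a $ b * shear $ d $ e)
    = trace (mixed ** mixed) - (trace mixed)\<^sup>2 / real CARD('d)"
proof -
  define X where "X = shear"
  have X_sym: "transpose X = X"
    using symmetric_entry[OF Kup_sym] symmetric_entry[OF Q_sym] by (simp add: X_def transpose_def vec_eq_iff)
  have "X ** q = mixed - (trace mixed / real CARD('d)) *\<^sub>R mat 1"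
    by (simp add: X_def matrix_diff_mult_distrib Kup_q matrix_mult_scaleR matrix_inv_left[OF q_inv])
  then have "trace ((X ** q) ** (X ** q)) = trace (mixed ** mixed) - (trace mixed)\<^sup>2 / real CARD('d)"
    by (simp only: trace_square_traceless) (simp add: power2_eq_square field_simps)
  moreover have "trace ((X ** q) ** (X ** q))
      = (\<Sum>a\<in>UNIV. \<Sum>b\<in>UNIV. \<Sum>d\<in>UNIV. \<Sum>e\<in>UNIV. X $ a $ b * (q $ b $ e * (X $ e $ d * q $ d $ a)))"
    unfolding matrix_mul_assoc[symmetric] trace_mul4
    by (rule sum.cong[OF refl], rule sum.cong[OF refl], rule sum.swap)
  moreover have "\<dots> = (\<Sum>a\<in>UNIV. \<Sum>b\<in>UNIV. \<Sum>d\<in>UNIV. \<Sum>e\<in>UNIV. q $ a $ d * q $ b $ e * X $ a $ b * X $ d $ e)"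
  proof (intro sum.cong refl)
    fix a b d e
    show "X $ a $ b * (q $ b $ e * (X $ e $ d * q $ d $ a)) = q $ a $ d * q $ b $ e * X $ a $ b * X $ d $ e"
      using symmetric_entry[OF q_sym, of d a] symmetric_entry[OF X_sym, of e d] by simp
  qed
  ultimately show ?thesis by (simp add: X_def)
qed

lemma shear_nonneg: "trace (mixed ** mixed) - (trace mixed)\<^sup>2 / real CARD('d) \<ge> 0"
  unfolding shear_square[symmetric] by (rule psd_contract_square_nonneg[OF q_sym q_psd])

context
  fixes \<kappa> lam \<Lambda> \<Delta>g \<delta> :: real
begin

abbreviation a where "a \<equiv> a_of TYPE('d) \<kappa> lam (phi M p)"
abbreviation s where "s \<equiv> sqrt_q M c y"

lemma s_pos: "s > 0" and s_square: "s\<^sup>2 = det q"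
  using det_q_pos by (simp_all add: sqrt_q_def)

lemma Ptr_eq:
  "Ptr \<kappa> lam M c y = (1 / \<kappa>) * a * s * (1 - real CARD('d)) * trace mixed
    + (2 * alpha TYPE('d) \<kappa> lam / \<kappa>) * s * phi M p * Ln_phi M c y * real CARD('d)"
proof -
  define A where "A = (1 / \<kappa>) * a * s"
  define B where "B = (2 * alpha TYPE('d) \<kappa> lam / \<kappa>) * s * phi M p * Ln_phi M c y"
  have "Ptr \<kappa> lam M c y = (\<Sum>i\<in>UNIV. \<Sum>j\<in>UNIV. A * (q $ i $ j * Kup M c y $ i $ j)
      + (B - A * trace mixed) * (q $ i $ j * Q $ i $ j))"
    by (simp add: Ptr_def Pup_def Let_def A_def B_def phi_slice_y Ktr_trace algebra_simps)
  also have "\<dots> = A * trace mixed + (B - A * trace mixed) * real CARD('d)"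
    by (simp add: sum.distrib sum_distrib_left[symmetric] q_Kup_contract q_Q_contract)
  finally show ?thesis by (simp add: A_def B_def algebra_simps diff_divide_distrib)
qed

text \<open>The term with Phi^2 K in \<open>pi_phi\<close> cancels the Phi^2 part of a in the trace
  of P, by the choice of the weight of Phi. The terms with Phi L_n Phi cancel by the value of
  \<open>alpha\<close>.\<close>

lemma conf_generator_eq:
  assumes "\<kappa> \<noteq> 0" "lam \<noteq> 0"
  shows "conf_generator \<kappa> lam \<Delta>g M c y = - ((real CARD('d) - 1) * \<Delta>g / \<kappa>) * s * trace mixed"
proof -
  have al: "alpha TYPE('d) \<kappa> lam * 8 * lam * real CARD('d) = - \<kappa> * (real CARD('d) - 1)"
    using assms by (simp add: alpha_def)
  \<comment> \<open>Eliminating \<open>lam\<close> in favour of \<open>alpha\<close> makes the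
    cancellation visible. For D = 1 this is impossible, but then \<open>alpha\<close> and the weight
    of Phi both vanish.\<close>
  have lam: "1 / lam = - (8 * alpha TYPE('d) \<kappa> lam * real CARD('d)) / (\<kappa> * (real CARD('d) - 1))"
    if "real CARD('d) \<noteq> 1"
    using al assms that by (simp add: field_simps)
  show ?thesis
  proof (cases "real CARD('d) = 1")
    case True
    then show ?thesis
      by (simp add: conf_generator_def Ptr_eq weight_phi_def alpha_def)
  next
    case False
    define D where "D = real CARD('d)"
    have D: "D - 1 \<noteq> 0" using False by (simp add: D_def)
    show ?thesis
      unfolding conf_generator_def Ptr_eq weight_phi_def pi_phi_def phi_slice_y Ktr_trace lam[OF False]
        a_of_def D_def[symmetric]
      using assms D by (simp add: field_simps power2_eq_square)
  qed
qed

text \<open>The contribution of L_n Phi to P^{ab} is pure trace and drops out.\<close>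

lemma Ptf_matrix:
  "Ptf \<kappa> lam M c y = ((1 / \<kappa>) * a * s) *\<^sub>R shear"
  by (simp add: Ptf_def vec_eq_iff Pup_def Let_def Ptr_eq phi_slice_y Ktr_trace
      algebra_simps add_divide_distrib diff_divide_distrib)

lemma Ptf_sq_eq:
  "Ptf_sq \<kappa> lam M c y = ((1 / \<kappa>) * a * s)\<^sup>2 *
    (trace (mixed ** mixed) - (trace mixed)\<^sup>2 / real CARD('d))"
  unfolding Ptf_sq_def Let_def Ptf_matrix shear_square[symmetric] sum_distrib_left
  by (intro sum.cong refl) (simp add: power2_eq_square)

theorem calP_ge:
  fixes D :: real
  assumes D: "D = real CARD('d)" "D \<ge> 2"
    and const: "\<kappa> > 0" "lam \<noteq> 0" "\<Delta>g \<noteq> 0" "a \<noteq> 0"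
    and gauge: "conf_generator \<kappa> lam \<Delta>g M c y - sqrt_q M c y * \<delta> = 0"
    and field: "field_equations \<kappa> lam \<Lambda> M"
    and wec: "weak_energy_condition \<kappa> lam M"
  shows "calP \<kappa> lam \<Lambda> \<Delta>g \<delta> M c y \<ge> \<delta>\<^sup>2 * (\<kappa>\<^sup>2 / (\<Delta>g\<^sup>2 * D * (D - 1)\<^sup>2)) - 2 / (D - 1) * \<Lambda>"
proof -
  define k where "k = trace mixed"
  define \<tau> where "\<tau> = trace (mixed ** mixed) - k\<^sup>2 / D"
  define R where "R = scalar_curv (qmet M c) y"
  have D': "D > 0" "D - 1 > 0" using D(2) by auto
  have "s * (- ((D - 1) * \<Delta>g / \<kappa>) * k) = s * \<delta>"
    using gauge const conf_generator_eq by (simp add: D(1) k_def mult_ac)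
  then have \<delta>: "\<delta> = - ((D - 1) * \<Delta>g / \<kappa>) * k"
    using s_pos by (simp only: mult_cancel_left) simp
  \<comment> \<open>The gauge condition as constant mean curvature, squared and free of
    division.\<close>
  have cmc: "\<delta>\<^sup>2 * \<kappa>\<^sup>2 = k\<^sup>2 * (\<Delta>g\<^sup>2 * (D - 1)\<^sup>2)"
    using const by (simp add: \<delta> power2_eq_square field_simps)
  have "einstein (gmet M c) (emb y) + \<Lambda> *\<^sub>R gmet M c (emb y)
      = (8 * pi) *\<^sub>R energy_momentum \<kappa> lam M c (emb y)"
    using field in_atlas emb_y_in by (simp add: field_equations_def)
  then have "bil (einstein (gmet M c) (emb y) + \<Lambda> *\<^sub>R gmet M c (emb y)) n n
      = bil ((8 * pi) *\<^sub>R energy_momentum \<kappa> lam M c (emb y)) n n"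
    by simp
  then have "bil (einstein (gmet M c) (emb y)) n n + \<Lambda> * bil (gmet M c (emb y)) n n
      = (8 * pi) * bil (energy_momentum \<kappa> lam M c (emb y)) n n"
    by (simp add: bil_def matrix_vector_mult_add_rdistrib inner_add_right scaleR_matrix_vector_assoc[symmetric])
  moreover have "bil (energy_momentum \<kappa> lam M c (emb y)) n n \<ge> 0"
    using wec in_atlas emb_y_in normal_norm normal_future
    by (simp add: weak_energy_condition_def future_timelike_def)
  then have "0 \<le> (8 * pi) * bil (energy_momentum \<kappa> lam M c (emb y)) n n"
    by simp
  ultimately have "bil (einstein (gmet M c) (emb y)) n n \<ge> \<Lambda>"
    unfolding normal_norm by linarith
  then have energy: "R + k\<^sup>2 - (\<tau> + k\<^sup>2 / D) \<ge> 2 * \<Lambda>"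
    using Hamiltonian_identity by (simp add: R_def k_def \<tau>_def)
  have \<tau>: "\<tau> \<ge> 0" using shear_nonneg by (simp add: \<tau>_def k_def D(1))
  have "Ptf_sq \<kappa> lam M c y = ((1 / \<kappa>) * a * s)\<^sup>2 * \<tau>"
    by (simp add: Ptf_sq_eq \<tau>_def k_def D(1))
  then have kinetic: "\<kappa>\<^sup>2 / (2 * det q * a\<^sup>2) * Ptf_sq \<kappa> lam M c y = \<tau> / 2"
    unfolding s_square[symmetric] using const s_pos by (simp add: power_mult_distrib power_divide field_simps)
  have t1: "\<delta>\<^sup>2 * (\<kappa>\<^sup>2 * (D + 1) / (2 * \<Delta>g\<^sup>2 * D * (D - 1)\<^sup>2)) = k\<^sup>2 * (D + 1) / (2 * D)"
  proof -
    have "\<delta>\<^sup>2 * (\<kappa>\<^sup>2 * (D + 1) / (2 * \<Delta>g\<^sup>2 * D * (D - 1)\<^sup>2))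
        = (\<delta>\<^sup>2 * \<kappa>\<^sup>2) * (D + 1) / (2 * \<Delta>g\<^sup>2 * D * (D - 1)\<^sup>2)" by simp
    then show ?thesis unfolding cmc using const D' by simp
  qed
  have t2: "\<delta>\<^sup>2 * (\<kappa>\<^sup>2 / (\<Delta>g\<^sup>2 * D * (D - 1)\<^sup>2)) = k\<^sup>2 / D"
  proof -
    have "\<delta>\<^sup>2 * (\<kappa>\<^sup>2 / (\<Delta>g\<^sup>2 * D * (D - 1)\<^sup>2)) = (\<delta>\<^sup>2 * \<kappa>\<^sup>2) / (\<Delta>g\<^sup>2 * D * (D - 1)\<^sup>2)" by simp
    then show ?thesis unfolding cmc using const D' by simp
  qed
  \<comment> \<open>Linear arithmetic with the nonlinear quantities made opaque: u stands for k^2 /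
    D and L for 2 / (D - 1) * \<Lambda>. Then C - (u - L) = \<tau> / 2 + (R + k^2 - u) / 2 -
    \<Lambda>, which is at least \<tau> by the energy inequality.\<close>
  have combine: "u - L \<le> C"
    if "C = \<tau> / 2 + R / 2 + X - Y" "X = k\<^sup>2 / 2 + u / 2" "Y = \<Lambda> + L" "R + k\<^sup>2 - (\<tau> + u) \<ge> 2 * \<Lambda>"
    for C X Y u L :: real
    using that \<tau> by linarith
  have "calP \<kappa> lam \<Lambda> \<Delta>g \<delta> M c y = \<tau> / 2 + R / 2 + k\<^sup>2 * (D + 1) / (2 * D) - (D + 1) / (D - 1) * \<Lambda>"
    unfolding calP_def Let_def D(1)[symmetric] phi_slice_y kinetic t1 by (simp add: R_def)
  moreover have "k\<^sup>2 * (D + 1) / (2 * D) = k\<^sup>2 / 2 + (k\<^sup>2 / D) / 2"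
    using D' by (simp add: field_simps)
  moreover have "(D + 1) / (D - 1) * \<Lambda> = \<Lambda> + 2 / (D - 1) * \<Lambda>"
    using D' by (simp add: field_simps)
  ultimately show ?thesis
    unfolding t2 by (rule combine[OF _ _ _ energy])
qed

end

end

section \<open>The maximum principle for the lapse\<close>

text \<open>Reduction to one variable along lines through y. The factor \<epsilon> covers maxima and
  minima at once; it will be the sign of the lapse at the extremum.\<close>

lemma second_derivative_test:
  fixes f :: "real^'n::finite \<Rightarrow> real"
  assumes f: "smooth_on S f" and S: "open S" "y \<in> S"
    and max: "\<And>z. z \<in> S \<Longrightarrow> \<epsilon> * f z \<le> \<epsilon> * f y"
  shows "\<epsilon> * partial UNIV i f y = 0"
    and "\<epsilon> * bil (\<chi> i j. partial UNIV i (partial UNIV j f) y) v v \<le> 0"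
proof -
  define G where "G v t = \<epsilon> * (\<Sum>i\<in>UNIV. v $ i * partial UNIV i f (y + t *\<^sub>R v))" for v t
  obtain r where r: "r > 0" "ball y r \<subseteq> S" using S open_contains_ball by blast
  \<comment> \<open>For |t| below this bound y + t v stays in the ball; adding 1 covers v =
    0.\<close>
  define e where "e v = r / (norm v + 1)" for v :: "real^'n"
  have e: "e v > 0" for v using r(1) by (simp add: e_def add_nonneg_pos)
  have near: "y + t *\<^sub>R v \<in> S" if "\<bar>t\<bar> < e v" for t v
  proof -
    have "\<bar>t\<bar> * norm v \<le> \<bar>t\<bar> * (norm v + 1)" by (simp add: mult_left_mono)
    also have "\<dots> < r" using that by (simp add: e_def pos_less_divide_eq add_nonneg_pos)
    finally have "y + t *\<^sub>R v \<in> ball y r" by (simp add: dist_norm)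
    then show ?thesis using r(2) by blast
  qed
  have der: "((\<lambda>s. \<epsilon> * f (y + s *\<^sub>R v)) has_real_derivative G v t) (at t)" if "\<bar>t\<bar> < e v" for t v
    unfolding G_def by (rule DERIV_cmult[OF line_derivative[OF smooth_on_differentiable[OF f near[OF that]]]])
  have G0: "G v 0 = 0" for v
  proof (rule DERIV_local_max[OF der[of 0 v] e[of v]])
    show "\<bar>0\<bar> < e v" using e by simp
    show "\<forall>t. \<bar>0 - t\<bar> < e v \<longrightarrow> \<epsilon> * f (y + t *\<^sub>R v) \<le> \<epsilon> * f (y + 0 *\<^sub>R v)"
      using max near by simp
  qed
  have "(\<Sum>j\<in>UNIV. (axis i 1 :: real^'n) $ j * partial UNIV j f y) = partial UNIV i f y"
    by (simp add: axis_def if_distrib[where f="\<lambda>z. z * _"] cong: if_cong)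
  with G0[of "axis i 1"] show "\<epsilon> * partial UNIV i f y = 0" by (simp add: G_def)
  define B where "B = \<epsilon> * bil (\<chi> i j. partial UNIV i (partial UNIV j f) y) v v"
  have "(G v has_real_derivative \<epsilon> * (\<Sum>j\<in>UNIV. v $ j * (\<Sum>i\<in>UNIV. v $ i * partial UNIV i (partial UNIV j f) (y + 0 *\<^sub>R v)))) (at 0)"
    unfolding G_def
    by (intro DERIV_cmult DERIV_sum line_derivative smooth_on_differentiable[OF smooth_on_partial[OF f]])
       (simp add: S)
  moreover have "(\<Sum>j\<in>UNIV. v $ j * (\<Sum>i\<in>UNIV. v $ i * partial UNIV i (partial UNIV j f) y))
      = bil (\<chi> i j. partial UNIV i (partial UNIV j f) y) v v"
    unfolding bil_sum sum_distrib_left by (subst sum.swap) (simp add: mult_ac)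
  ultimately have G': "(G v has_real_derivative B) (at 0)" by (simp add: B_def)
  have "B \<le> 0"
  proof (rule ccontr)
    assume "\<not> B \<le> 0"
    \<comment> \<open>A positive second derivative would make the first derivative, zero at 0,
      positive just to the right, and the mean value theorem would give a value above the
      maximum.\<close>
    then obtain d where d: "d > 0" "\<And>h. 0 < h \<Longrightarrow> h < d \<Longrightarrow> G v 0 < G v (0 + h)"
      using DERIV_pos_inc_right[OF G'] by (metis not_le)
    define h where "h = min d (e v) / 2"
    have h: "0 < h" "h < d" "h < e v" using d(1) e[of v] by (auto simp: h_def)
    have "\<exists>z. 0 < z \<and> z < h \<and> \<epsilon> * f (y + h *\<^sub>R v) - \<epsilon> * f (y + 0 *\<^sub>R v) = (h - 0) * G v z"
      by (rule MVT2[OF h(1)], rule der) (use h in auto)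
    then obtain z where z: "0 < z" "z < h" "\<epsilon> * f (y + h *\<^sub>R v) - \<epsilon> * f y = h * G v z"
      by auto
    have "G v z > 0" using d(2)[of z] z h G0[of v] by simp
    then have "\<epsilon> * f (y + h *\<^sub>R v) > \<epsilon> * f y" using z(3) h(1) by (smt (verit) mult_pos_pos)
    moreover have "y + h *\<^sub>R v \<in> S" using near[of h v] h by simp
    ultimately show False using max by (meson not_le)
  qed
  then show "\<epsilon> * bil (\<chi> i j. partial UNIV i (partial UNIV j f) y) v v \<le> 0" by (simp add: B_def)
qed

lemma partial_interior:
  assumes V: "open V" "z \<in> V" "V \<subseteq> S" and eq: "\<And>x. x \<in> V \<Longrightarrow> f x = g x"
  shows "partial S i f z = partial UNIV i g z"
proof -
  have "at z within S = at z"
    using V by (metis at_within_interior interior_maximal subsetD)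
  then have "partial S i f z = partial UNIV i f z" by (simp add: partial_def)
  then show ?thesis using partial_cong_open[OF V(1,2) eq] by simp
qed

text \<open>The first derivatives vanish at the maximum, so the Christoffel terms of the Hessian
  drop out; what remains is a semidefinite Hessian contracted with the inverse metric. F replaces f
  because f is controlled only on S.\<close>

lemma laplacian_at_max:
  fixes h :: "real^'n::finite \<Rightarrow> real^'n^'n"
  assumes F: "smooth_on V F" and V: "open V" "y \<in> V" "V \<subseteq> S"
    and eq: "\<And>z. z \<in> V \<Longrightarrow> f z = F z"
    and max: "\<And>z. z \<in> V \<Longrightarrow> \<epsilon> * f z \<le> \<epsilon> * f y"
    and h: "transpose (matrix_inv (h y)) = matrix_inv (h y)" "\<And>v. bil (matrix_inv (h y)) v v \<ge> 0"
  shows "\<epsilon> * laplacian h S f y \<le> 0"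
proof -
  have max': "\<epsilon> * F z \<le> \<epsilon> * F y" if "z \<in> V" for z using max[OF that] eq that V(2) by simp
  note test = second_derivative_test[OF F V(1,2) max']
  have d1: "partial S i f z = partial UNIV i F z" if "z \<in> V" for i z
    by (rule partial_interior[OF V(1) that V(3) eq])
  have d2: "partial S i (partial S j f) y = partial UNIV i (partial UNIV j F) y" for i j
    by (rule partial_interior[OF V d1])
  define H :: "real^'n^'n" where "H = \<epsilon> *\<^sub>R (\<chi> i j. partial UNIV i (partial UNIV j F) y)"
  have H: "H $ i $ j = \<epsilon> * cov_hessian h S f y $ i $ j" for i j
  proof -
    have "\<epsilon> * (\<Sum>k\<in>UNIV. christoffel h y k i j * partial UNIV k F y) = 0"
      unfolding sum_distrib_left by (rule sum.neutral) (use test(1) in \<open>auto simp: mult.left_commute\<close>)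
    then show ?thesis by (simp add: cov_hessian_def d1[OF V(2)] d2 H_def right_diff_distrib)
  qed
  have "\<epsilon> * laplacian h S f y = (\<Sum>i\<in>UNIV. \<Sum>j\<in>UNIV. matrix_inv (h y) $ i $ j * H $ i $ j)"
    by (simp add: H laplacian_def sum_distrib_left mult_ac)
  also have "\<dots> \<le> 0"
  proof (rule psd_contract_nonpos[OF h])
    show "bil H v v \<le> 0" for v
      using test(2)[of v] by (simp add: H_def bil_def scaleR_matrix_vector_assoc[symmetric])
  qed
  finally show ?thesis .
qed

text \<open>A derivative within a set is unique only if the set contains nearby points along every
  axis; otherwise \<open>frechet_derivative\<close> could choose a nonzero map even for a function
  vanishing on S.\<close>

lemma partial_vanishing:
  assumes z: "z \<in> S" and f: "\<And>x. x \<in> S \<Longrightarrow> f x = 0"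
    and S: "\<And>k e. e > 0 \<Longrightarrow> \<exists>d. 0 < \<bar>d\<bar> \<and> \<bar>d\<bar> < e \<and> z + d *\<^sub>R axis k 1 \<in> S"
  shows "partial S i f z = 0"
proof -
  have 0: "(f has_derivative (\<lambda>_. 0)) (at z within S)"
    by (rule has_derivative_transform[OF z f has_derivative_const])
  then have "(f has_derivative frechet_derivative f (at z within S)) (at z within S)"
    using differentiableI frechet_derivative_works by blast
  then have "frechet_derivative f (at z within S) = (\<lambda>_. 0)"
    by (rule frechet_derivative_unique_within[OF _ 0]) (use S in \<open>auto simp: Basis_vec_def\<close>)
  then show ?thesis by (simp add: partial_def)
qed

lemma laplacian_vanishing:
  assumes y: "y \<in> S" and f: "\<And>x. x \<in> S \<Longrightarrow> f x = 0"
    and S: "\<And>z k e. z \<in> S \<Longrightarrow> e > 0 \<Longrightarrow> \<exists>d. 0 < \<bar>d\<bar> \<and> \<bar>d\<bar> < e \<and> z + d *\<^sub>R axis k 1 \<in> S"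
  shows "laplacian h S f y = 0"
proof -
  have d1: "partial S i f z = 0" if "z \<in> S" for i z
    by (rule partial_vanishing[OF that f S[OF that]])
  have d2: "partial S i (partial S j f) y = 0" for i j
    by (rule partial_vanishing[OF y d1 S[OF y]])
  show ?thesis by (simp add: laplacian_def cov_hessian_def d1[OF y] d2)
qed

section \<open>Slice charts: half-space shape, interior points, boundary points\<close>

context slice_point
begin

lemma param_props:
  assumes "emb z \<in> codom c"
  shows "param c (emb z) \<in> fst c" and "snd c (param c (emb z)) = emb z" and "spat c (param c (emb z)) = z"
proof -
  have "homeomorphism (fst c) (codom c) (snd c) (param c)" using chart by (simp add: is_chart_def)
  then show "param c (emb z) \<in> fst c" "snd c (param c (emb z)) = emb z"
    using assms by (auto simp: homeomorphism_def)
  then show "spat c (param c (emb z)) = z" by (simp add: spat_def)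
qed

lemma slice_domI: "emb z \<in> codom c \<Longrightarrow> param c (emb z) \<in> \<sigma> \<Longrightarrow> z \<in> slice_dom \<sigma> c"
  unfolding slice_dom_def using param_props by (metis IntI imageI)

lemma slice_domE:
  assumes "z \<in> slice_dom \<sigma> c"
  shows "emb z \<in> codom c" and "param c (emb z) \<in> \<sigma>"
proof -
  obtain r where r: "r \<in> \<sigma>" "r \<in> fst c" "z = spat c r" using assms by (auto simp: slice_dom_def)
  have "snd c r $ None = 0"
    using c_in r by (auto simp: slice_charts_at_def interior_slice_chart_def boundary_slice_chart_def)
  then have e: "emb z = snd c r"
    by (simp add: r vec_eq_iff emb_def spat_def split: option.split)
  then show "emb z \<in> codom c" using r by (simp add: codom_def)
  show "param c (emb z) \<in> \<sigma>"
    unfolding e using chart r(1,2) by (simp add: is_chart_def homeomorphism_def)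
qed

lemma y_in_dom: "y \<in> slice_dom \<sigma> c"
  using slice_domI emb_y_in param_emb_y p_in by simp

lemma param_in_slice_cases:
  obtains (interior) "\<And>z. emb z \<in> codom c \<Longrightarrow> param c (emb z) \<in> \<sigma>"
  | (boundary) b where "boundary_slice_chart M \<sigma> b c"
      "\<And>z. emb z \<in> codom c \<Longrightarrow> param c (emb z) \<in> \<sigma> \<longleftrightarrow> z $ b \<ge> 0"
proof -
  consider "interior_slice_chart M \<sigma> c" | b where "boundary_slice_chart M \<sigma> b c"
    using c_in by (auto simp: slice_charts_at_def)
  then show ?thesis
  proof cases
    case 1
    then have eq: "\<sigma> \<inter> fst c = {r \<in> fst c. snd c r $ None = 0}"
      by (simp add: interior_slice_chart_def)
    have "param c (emb z) \<in> \<sigma> \<inter> fst c" if "emb z \<in> codom c" for z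
      unfolding eq using param_props[OF that] by simp
    then have "param c (emb z) \<in> \<sigma>" if "emb z \<in> codom c" for z
      using that by blast
    then show ?thesis by (rule interior)
  next
    case (2 b)
    then have eq: "\<sigma> \<inter> fst c = {r \<in> fst c. snd c r $ None = 0 \<and> snd c r $ Some b \<ge> 0}"
      by (simp add: boundary_slice_chart_def)
    have "param c (emb z) \<in> \<sigma> \<longleftrightarrow> z $ b \<ge> 0" if "emb z \<in> codom c" for z
    proof -
      have "param c (emb z) \<in> \<sigma> \<inter> fst c \<longleftrightarrow> z $ b \<ge> 0"
        unfolding eq using param_props[OF that] by simp
      then show ?thesis using param_props[OF that] by blast
    qed
    then show ?thesis by (rule boundary[OF 2])
  qed
qed

lemma interior_neighbourhood:
  assumes "p \<notin> slice_boundary M \<sigma>"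
  obtains V where "open V" "y \<in> V" "V \<subseteq> slice_dom \<sigma> c"
proof (cases rule: param_in_slice_cases)
  case interior
  show ?thesis
    by (rule that[of "emb -` codom c"])
       (use open_vimage_emb[OF open_U] emb_y_in interior slice_domI in auto)
next
  case (boundary b)
  have "y $ b \<ge> 0" using boundary(2)[OF emb_y_in] p_in by (simp add: param_emb_y)
  moreover have "y $ b \<noteq> 0"
  proof
    assume "y $ b = 0"
    then have "snd c p $ Some b = 0" by (simp add: spat_def)
    then show False using assms boundary(1) p_in p_in_chart by (auto simp: slice_boundary_def)
  qed
  ultimately have "y $ b > 0" by simp
  have "open {z :: real^'d. z $ b > 0}"
    by (intro open_Collect_less continuous_intros)
  then have op: "open ((emb -` codom c) \<inter> {z. z $ b > 0})"
    by (rule open_Int[OF open_vimage_emb[OF open_U]])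
  show ?thesis
    by (rule that[OF op]) (use \<open>y $ b > 0\<close> emb_y_in boundary slice_domI in auto)
qed

text \<open>A small positive step along any axis stays in the half-space z_b >= 0, so boundary
  points are accessible too. This supplies the uniqueness condition of
  \<open>laplacian_vanishing\<close>.\<close>

lemma slice_dom_axis_accessible:
  assumes z: "z \<in> slice_dom \<sigma> c" and e: "e > 0"
  shows "\<exists>d. 0 < \<bar>d\<bar> \<and> \<bar>d\<bar> < e \<and> z + d *\<^sub>R axis k 1 \<in> slice_dom \<sigma> c"
proof -
  obtain r where r: "r > 0" "ball z r \<subseteq> emb -` codom c"
    using open_vimage_emb[OF open_U] slice_domE(1)[OF z] open_contains_ball by (metis vimageI2)
  define d where "d = min r e / 2"
  have d: "d > 0" "d < r" "d < e" using r e by (auto simp: d_def)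
  have "z + d *\<^sub>R axis k 1 \<in> ball z r" using d by (simp add: dist_norm)
  then have emb: "emb (z + d *\<^sub>R axis k 1) \<in> codom c" using r by blast
  have "param c (emb (z + d *\<^sub>R axis k 1)) \<in> \<sigma>"
  proof (cases rule: param_in_slice_cases)
    case interior
    then show ?thesis using emb by blast
  next
    case (boundary b)
    have "z $ b \<ge> 0" using boundary(2) slice_domE[OF z] by blast
    then have "(z + d *\<^sub>R axis k 1) $ b \<ge> 0" using d by (simp add: axis_def)
    then show ?thesis using boundary(2)[OF emb] by blast
  qed
  then show ?thesis using d slice_domI[OF emb] by (intro exI[of _ d]) auto
qed

lemma slice_laplacian_vanishing:
  assumes "\<And>r. r \<in> \<sigma> \<Longrightarrow> N r = 0"
  shows "laplacian (qmet M c) (slice_dom \<sigma> c) (\<lambda>z. N (param c (emb z))) y = 0"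
  using y_in_dom assms slice_domE(2) slice_dom_axis_accessible
  by (intro laplacian_vanishing) blast+

lemma chart_image_open:
  assumes "open W"
  shows "open (snd c ` (fst c \<inter> W))"
proof -
  have "openin (top_of_set (codom c)) (snd c ` (fst c \<inter> W))"
    using chart assms unfolding is_chart_def
    by (intro homeomorphism_imp_open_map[of "fst c" _ "snd c" "param c"]) (auto simp: openin_open)
  then show ?thesis using open_U openin_open_trans by blast
qed

lemma slice_laplacian_at_max:
  assumes N: "smooth_on_slice M \<sigma> N" and interior: "p \<notin> slice_boundary M \<sigma>"
    and max: "\<And>r. r \<in> \<sigma> \<Longrightarrow> \<epsilon> * N r \<le> \<epsilon> * N p"
  shows "\<epsilon> * laplacian (qmet M c) (slice_dom \<sigma> c) (\<lambda>z. N (param c (emb z))) y \<le> 0"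
proof -
  obtain W F where W: "open W" "p \<in> W" and F: "smooth_fun_on (atlas M) W F"
    and FN: "\<And>r. r \<in> \<sigma> \<inter> W \<Longrightarrow> F r = N r"
    using bspec[OF N[unfolded smooth_on_slice_def] p_in] by (elim exE conjE) simp
  define O' where "O' = snd c ` (fst c \<inter> W)"
  have O': "open O'" unfolding O'_def by (rule chart_image_open[OF W(1)])
  have "smooth_on O' (F \<circ> param c)"
    using F in_atlas by (simp add: smooth_fun_on_def O'_def)
  then have sm: "smooth_on (emb -` O') (\<lambda>z. F (param c (emb z)))"
    using smooth_on_compose_emb[OF _ O', of "F \<circ> param c"] by simp
  obtain V where V: "open V" "y \<in> V" "V \<subseteq> slice_dom \<sigma> c"
    using interior_neighbourhood[OF interior] by blast
  define V' where "V' = V \<inter> emb -` O'"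
  have V': "open V'" "y \<in> V'" "V' \<subseteq> slice_dom \<sigma> c"
    using V open_vimage_emb[OF O'] W(2) p_in_chart by (auto simp: V'_def O'_def emb_y)
  show ?thesis
  proof (rule laplacian_at_max[OF smooth_on_subset[OF sm] V'])
    show "V' \<subseteq> emb -` O'" by (auto simp: V'_def)
    fix z
    assume z: "z \<in> V'"
    then obtain r where r: "r \<in> fst c" "r \<in> W" "emb z = snd c r" by (auto simp: V'_def O'_def)
    then have "param c (emb z) = r" using chart by (simp add: is_chart_def homeomorphism_def)
    moreover have "param c (emb z) \<in> \<sigma>" using slice_domE(2) V'(3) z by blast
    ultimately show "N (param c (emb z)) = F (param c (emb z))" using FN[of r] r by simp
    show "\<epsilon> * N (param c (emb z)) \<le> \<epsilon> * N (param c (emb y))"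
      using max slice_domE(2) V'(3) z by (simp add: param_emb_y subset_iff)
  next
    show "transpose (matrix_inv q) = matrix_inv q" by (rule Q_sym)
    show "bil (matrix_inv q) v v \<ge> 0" for v
      by (rule pos_def_matrix_inv_psd[OF q_sym q_pos])
  qed
qed

end

section \<open>Uniqueness of the solution of the lapse equation\<close>

lemma smooth_on_slice_continuous:
  fixes M :: "('m::t2_space, 'd::finite) spacetime"
  assumes M: "spacetime_with_scalar M" and N: "smooth_on_slice M \<sigma> N"
  shows "continuous_on \<sigma> N"
proof (unfold continuous_on_eq_continuous_within, rule ballI)
  fix p
  assume p: "p \<in> \<sigma>"
  obtain W F where W: "open W" "p \<in> W" and F: "smooth_fun_on (atlas M) W F"
    and FN: "\<And>r. r \<in> \<sigma> \<inter> W \<Longrightarrow> F r = N r"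
    using bspec[OF N[unfolded smooth_on_slice_def] p] by (elim exE conjE) simp
  obtain c where c: "c \<in> atlas M" "p \<in> fst c"
    using M unfolding spacetime_with_scalar_def maximal_atlas_def by blast
  have chart: "is_chart c" using M c by (simp add: spacetime_with_scalar_def maximal_atlas_def)
  then have hom: "homeomorphism (fst c) (codom c) (snd c) (param c)" and opc: "open (fst c)"
    by (simp_all add: is_chart_def)
  have "continuous_on (snd c ` (fst c \<inter> W)) (F \<circ> param c)"
    by (rule smooth_on_continuous) (use F c(1) in \<open>simp add: smooth_fun_on_def\<close>)
  moreover have "continuous_on (fst c \<inter> W) (snd c)"
    using hom by (auto simp: homeomorphism_def intro: continuous_on_subset)
  ultimately have "continuous_on (fst c \<inter> W) ((F \<circ> param c) \<circ> snd c)"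
    by (rule continuous_on_compose[rotated])
  then have "continuous_on (fst c \<inter> W) F"
  proof (rule continuous_on_eq)
    show "((F \<circ> param c) \<circ> snd c) r = F r" if "r \<in> fst c \<inter> W" for r
      using that hom by (simp add: homeomorphism_def)
  qed
  then have "continuous_on (\<sigma> \<inter> (fst c \<inter> W)) F"
    by (rule continuous_on_subset) auto
  then have "continuous_on (\<sigma> \<inter> (fst c \<inter> W)) N"
    by (rule continuous_on_eq) (use FN in auto)
  then have "continuous (at p within \<sigma> \<inter> (fst c \<inter> W)) N"
    using p c W by (simp add: continuous_on_eq_continuous_within)
  moreover have "at p within \<sigma> \<inter> (fst c \<inter> W) = at p within \<sigma>"
    by (rule at_within_nhd[of p "fst c \<inter> W"]) (use p c W opc in auto)
  ultimately show "continuous (at p within \<sigma>) N" by simp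
qed

theorem lapse_equation_only_zero:
  fixes M :: "('m::t2_space, 'd::finite) spacetime"
  assumes M: "spacetime_with_scalar M" and slice: "compact_spatial_slice M \<sigma>"
    and P: "\<And>p c. p \<in> \<sigma> \<Longrightarrow> c \<in> slice_charts_at M \<sigma> p \<Longrightarrow> calP \<kappa> lam \<Lambda> \<Delta>g \<delta> M c (spat c p) > 0"
    and N: "solves_lapse_equation \<kappa> lam \<Lambda> \<Delta>g \<delta> M \<sigma> N"
    and r: "r \<in> \<sigma>"
  shows "N r = 0"
proof (rule ccontr)
  assume Nr: "N r \<noteq> 0"
  have N_smooth: "smooth_on_slice M \<sigma> N" and bdry: "\<And>p. p \<in> slice_boundary M \<sigma> \<Longrightarrow> N p = 0"
    using N by (auto simp: solves_lapse_equation_def lapse_function_def)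
  have "compact \<sigma>" using slice by (simp add: compact_spatial_slice_def)
  moreover have "continuous_on \<sigma> (\<lambda>p. \<bar>N p\<bar>)"
    by (intro continuous_intros smooth_on_slice_continuous[OF M N_smooth])
  ultimately obtain p where p: "p \<in> \<sigma>" "\<And>x. x \<in> \<sigma> \<Longrightarrow> \<bar>N x\<bar> \<le> \<bar>N p\<bar>"
    using continuous_attains_sup[of \<sigma> "\<lambda>p. \<bar>N p\<bar>"] r by blast
  have Np: "N p \<noteq> 0" using p(2)[OF r] Nr by auto
  obtain c where c: "c \<in> slice_charts_at M \<sigma> p"
    using slice p(1) unfolding compact_spatial_slice_def by blast
  interpret slice_point M \<sigma> p c
    by unfold_locales (fact M slice p(1) c)+
  define L where "L = laplacian (qmet M c) (slice_dom \<sigma> c) (\<lambda>z. N (param c (emb z))) (spat c p)"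
  \<comment> \<open>Multiplying by the sign of N p turns the maximum of |N| into a maximum of a
    smooth function, whichever sign N has there.\<close>
  have "sgn (N p) * L \<le> 0"
    unfolding L_def
  proof (rule slice_laplacian_at_max[OF N_smooth])
    show "p \<notin> slice_boundary M \<sigma>" using bdry Np by blast
    show "sgn (N p) * N x \<le> sgn (N p) * N p" if "x \<in> \<sigma>" for x
      using p(2)[OF that] by (auto simp: sgn_if abs_if split: if_splits)
  qed
  moreover have "L = calP \<kappa> lam \<Lambda> \<Delta>g \<delta> M c (spat c p) * N p"
    using N p(1) c unfolding solves_lapse_equation_def lapse_op_def L_def
    by (fastforce simp: param_emb_y)
  ultimately have "calP \<kappa> lam \<Lambda> \<Delta>g \<delta> M c (spat c p) * \<bar>N p\<bar> \<le> 0"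
    by (simp add: abs_sgn mult_ac)
  moreover have "calP \<kappa> lam \<Lambda> \<Delta>g \<delta> M c (spat c p) * \<bar>N p\<bar> > 0"
    using P[OF p(1) c] Np by simp
  ultimately show False by simp
qed

lemma smooth_on_zero:
  fixes S :: "(real^'n::finite) set"
  shows "smooth_on S (\<lambda>_. 0)"
proof -
  have "Ck_on k S (\<lambda>_ :: real^'n. 0)" for k
  proof (induction k)
    case (Suc k)
    have "partial UNIV i (\<lambda>_ :: real^'n. 0) = (\<lambda>_. 0)" for i
      by (rule ext) (rule partial_const)
    with Suc show ?case by simp
  qed simp
  then show ?thesis by (simp add: smooth_on_def)
qed

text \<open>N is arbitrary off the slice, so the Laplacian vanishes because its derivatives are
  taken within \<open>slice_dom\<close>.\<close>

lemma zero_solves_lapse_equation: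
  assumes M: "spacetime_with_scalar M" and slice: "compact_spatial_slice M \<sigma>"
    and N: "\<And>p. p \<in> \<sigma> \<Longrightarrow> N p = 0"
  shows "solves_lapse_equation \<kappa> lam \<Lambda> \<Delta>g \<delta> M \<sigma> N"
proof -
  have "smooth_fun_on (atlas M) UNIV (\<lambda>_. 0)"
    by (simp add: smooth_fun_on_def smooth_on_zero comp_def)
  then have "smooth_on_slice M \<sigma> N"
    unfolding smooth_on_slice_def using N by (metis IntD1 UNIV_I open_UNIV)
  then have "lapse_function M \<sigma> N"
    using N by (auto simp: lapse_function_def slice_boundary_def)
  moreover have "lapse_op \<kappa> lam \<Lambda> \<Delta>g \<delta> M \<sigma> c N (spat c p) = 0"
    if "p \<in> \<sigma>" "c \<in> slice_charts_at M \<sigma> p" for p c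
  proof -
    interpret slice_point M \<sigma> p c
      by unfold_locales (fact M slice that)+
    show ?thesis
      using slice_laplacian_vanishing[where N = N] N that(1) by (simp add: lapse_op_def param_emb_y)
  qed
  ultimately show ?thesis by (simp add: solves_lapse_equation_def)
qed

theorem mainTheorem3:
  fixes M :: "('m::{t2_space,second_countable_topology}, 'd::finite) spacetime"
    and \<sigma> :: "'m set"
    and \<kappa> lam \<Lambda> \<Delta>g \<delta> D :: real
  assumes "D = real CARD('d)" and "CARD('d) \<ge> 2"
    and "\<kappa> > 0" and "lam \<noteq> 0" and "\<Delta>g \<noteq> 0"
    and "spacetime_with_scalar M"
    and "field_equations \<kappa> lam \<Lambda> M"
    and "compact_spatial_slice M \<sigma>"
    and "\<forall>p\<in>\<sigma>. a_of TYPE('d) \<kappa> lam (phi M p) \<noteq> 0"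
    and "gauge_condition \<kappa> lam \<Delta>g \<delta> M \<sigma>"
    and "weak_energy_condition \<kappa> lam M"
  shows "(\<forall>p\<in>\<sigma>. \<forall>c\<in>slice_charts_at M \<sigma> p.
            calP \<kappa> lam \<Lambda> \<Delta>g \<delta> M c (spat c p)
              \<ge> \<delta>\<^sup>2 * (\<kappa>\<^sup>2 / (\<Delta>g\<^sup>2 * D * (D - 1)\<^sup>2)) - 2 / (D - 1) * \<Lambda>) \<and>
         (\<delta>\<^sup>2 > 2 * \<Delta>g\<^sup>2 * D * (D - 1) / \<kappa>\<^sup>2 * \<Lambda> \<longrightarrow>
            (\<forall>N. solves_lapse_equation \<kappa> lam \<Lambda> \<Delta>g \<delta> M \<sigma> N \<longleftrightarrow> (\<forall>p\<in>\<sigma>. N p = 0)) \<and>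
            locally_good_gauge_fixing \<kappa> lam \<Lambda> \<Delta>g \<delta> M \<sigma>) \<and>
         (\<Lambda> < 0 \<longrightarrow> \<delta>\<^sup>2 > 2 * \<Delta>g\<^sup>2 * D * (D - 1) / \<kappa>\<^sup>2 * \<Lambda>)"
proof (intro conjI impI ballI)
  note D = assms(1)
  have D2: "D \<ge> 2" using assms(1,2) by simp
  show bound: "calP \<kappa> lam \<Lambda> \<Delta>g \<delta> M c (spat c p)
      \<ge> \<delta>\<^sup>2 * (\<kappa>\<^sup>2 / (\<Delta>g\<^sup>2 * D * (D - 1)\<^sup>2)) - 2 / (D - 1) * \<Lambda>"
    if "p \<in> \<sigma>" "c \<in> slice_charts_at M \<sigma> p" for p c
  proof -
    interpret slice_point M \<sigma> p c
      by unfold_locales (fact assms that)+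
    have "a_of TYPE('d) \<kappa> lam (phi M p) \<noteq> 0"
      and "conf_generator \<kappa> lam \<Delta>g M c (spat c p) - sqrt_q M c (spat c p) * \<delta> = 0"
      using assms(9,10) that by (auto simp: gauge_condition_def)
    then show ?thesis using calP_ge assms D2 by blast
  qed
  {
    assume \<delta>: "2 * \<Delta>g\<^sup>2 * D * (D - 1) / \<kappa>\<^sup>2 * \<Lambda> < \<delta>\<^sup>2"
    \<comment> \<open>The assumption on \<delta> times the positive factor in front of \<delta>^2 in
      the bound; it says that the lower bound of \<open>calP\<close> is positive.\<close>
    have "2 / (D - 1) * \<Lambda> < \<delta>\<^sup>2 * (\<kappa>\<^sup>2 / (\<Delta>g\<^sup>2 * D * (D - 1)\<^sup>2))"
    proof -
      have pos: "\<kappa>\<^sup>2 / (\<Delta>g\<^sup>2 * D * (D - 1)\<^sup>2) > 0"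
        using D2 assms(3,5) by simp
      have "2 / (D - 1) * \<Lambda>
          = 2 * \<Delta>g\<^sup>2 * D * (D - 1) / \<kappa>\<^sup>2 * \<Lambda> * (\<kappa>\<^sup>2 / (\<Delta>g\<^sup>2 * D * (D - 1)\<^sup>2))"
        using D2 assms(3,5) by (simp add: power2_eq_square)
      also have "\<dots> < \<delta>\<^sup>2 * (\<kappa>\<^sup>2 / (\<Delta>g\<^sup>2 * D * (D - 1)\<^sup>2))"
        using \<delta> pos by (rule mult_strict_right_mono)
      finally show ?thesis .
    qed
    then have P: "calP \<kappa> lam \<Lambda> \<Delta>g \<delta> M c (spat c p) > 0"
      if "p \<in> \<sigma>" "c \<in> slice_charts_at M \<sigma> p" for p c
      using bound[OF that] by linarith
    note unique = lapse_equation_only_zero[OF assms(6,8) P]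
    show "\<forall>N. solves_lapse_equation \<kappa> lam \<Lambda> \<Delta>g \<delta> M \<sigma> N \<longleftrightarrow> (\<forall>p\<in>\<sigma>. N p = 0)"
    proof (intro allI iffI ballI)
      show "N p = 0" if "solves_lapse_equation \<kappa> lam \<Lambda> \<Delta>g \<delta> M \<sigma> N" "p \<in> \<sigma>" for N p
        by (rule unique[OF _ _ that])
      show "solves_lapse_equation \<kappa> lam \<Lambda> \<Delta>g \<delta> M \<sigma> N" if "\<forall>p\<in>\<sigma>. N p = 0" for N
        by (rule zero_solves_lapse_equation[OF assms(6,8)]) (use that in blast)
    qed
    show "locally_good_gauge_fixing \<kappa> lam \<Lambda> \<Delta>g \<delta> M \<sigma>"
      unfolding locally_good_gauge_fixing_def
    proof (intro allI impI ballI, elim conjE)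
      fix N p
      assume N: "lapse_function M \<sigma> N" and p: "p \<in> \<sigma>"
        and br: "\<forall>p\<in>\<sigma>. \<forall>c\<in>slice_charts_at M \<sigma> p.
          bracket_op \<kappa> lam \<Lambda> \<Delta>g \<delta> M \<sigma> c N (spat c p) = 0"
      \<comment> \<open>The factor (D - 1) sqrt q \<Delta>g that distinguishes
        \<open>bracket_op\<close> from \<open>lapse_op\<close> is nonzero, so both have the same
        kernel.\<close>
      have "lapse_op \<kappa> lam \<Lambda> \<Delta>g \<delta> M \<sigma> c N (spat c r) = 0"
        if r: "r \<in> \<sigma>" "c \<in> slice_charts_at M \<sigma> r" for r c
      proof -
        interpret slice_point M \<sigma> r c
          by unfold_locales (fact assms r)+
        have "bracket_op \<kappa> lam \<Lambda> \<Delta>g \<delta> M \<sigma> c N (spat c r) = 0" using br r by blast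
        then show ?thesis
          using s_pos assms(2,5) by (simp add: bracket_op_def)
      qed
      then have "solves_lapse_equation \<kappa> lam \<Lambda> \<Delta>g \<delta> M \<sigma> N"
        using N by (simp add: solves_lapse_equation_def)
      from unique[OF _ _ this p] show "N p = 0" .
    qed
  }
  show "2 * \<Delta>g\<^sup>2 * D * (D - 1) / \<kappa>\<^sup>2 * \<Lambda> < \<delta>\<^sup>2" if "\<Lambda> < 0"
  proof -
    have "2 * \<Delta>g\<^sup>2 * D * (D - 1) / \<kappa>\<^sup>2 > 0" using D2 assms(3,5) by simp
    then have "2 * \<Delta>g\<^sup>2 * D * (D - 1) / \<kappa>\<^sup>2 * \<Lambda> < 0" using that by (rule mult_pos_neg)
    then show ?thesis by (smt (verit) zero_le_power2)
  qed
qed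

end
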